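(* Let $x\in\mathcal S$ with $x\neq x_{\max}$. Then: (a) for every sufficiently small real $\varepsilon>0$, $$X^\varepsilon(x):=\{x'\in\mathcal S:\ x'\prec_F x,\ |x'-x|=\varepsilon\}=\{x+\Delta^{\phi,\psi}:\ (\phi,\psi)\in\mathcal P^\varepsilon(x)\};$$ (b) if $y\in\mathcal S$ and $y\prec_F x$, then for every sufficiently small $\varepsilon>0$ there exists $x'\in X^\varepsilon(x)$ with $y\preceq_F x'\prec_F x$.
   Context: Setting. $G=(V,E)$ is a finite bipartite graph with vertex classes $F$ and $W$; an edge with ends $f\in F$, $w\in W$ is written $fw$. There are capacities $b:E\to\mathbb R_{>0}$ and quotas $q:V\to\mathbb R_{>0}$. For $v\in V$, $E_v$ is the set of edges incident to $v$, and $v$ has a weak linear order on $E_v$ given by an ordered partition $\Pi_v=(\pi^1,\dots,\pi^k)$ of $E_v$ into nonempty ties; $\pi^i$ is better than $\pi^j$ when $i<j$. For $a\in\mathbb R^E$ and $S\subseteq E$, $a(S)=\sum_{e\in S}a(e)$, $|a|=\sum_{e\in E}|a(e)|$, and $a_v$ is the restriction of $a$ to $E_v$. An assignment is $x\in\mathbb R^E$ with $0\le x\le b$ and $x(E_v)\le q(v)$ for all $v$. For an assignment $x$ and $v\in V$: if $x(E_v)=q(v)$ ($v$ fully filled), the critical tie $\pi^c_v(x)$ is the tie $\pi^i$ with $x(\pi^1\cup\dots\cup\pi^{i-1})<q(v)\le x(\pi^1\cup\dots\cup\pi^i)$, the head $H_v(x)$ is the set of edges of $\pi^c_v(x)$ where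 $x$ attains its maximum over $\pi^c_v(x)$, $E^{\rm end}_v(x)$ is the union of ties worse than $\pi^c_v(x)$, and the tail is $T_v(x)=E_v\setminus(H_v(x)\cup E^{\rm end}_v(x))$; if $x(E_v)<q(v)$ ($v$ deficit), $H_v(x)=\emptyset$, $T_v(x)=E_v$. An edge $e=fw$ is blocking for $x$ if $x(e)<b(e)$ and $e\in T_f(x)\cap T_w(x)$; $x$ is stable if no edge is blocking; $\mathcal S$ is the set of stable assignments. Preferences. For $v\in V$ and $z\in\mathbb R^{E_v}$ with $0\le z\le b_v$, the choice function is $C_v(z)=z$ if $z(E_v)\le q(v)$; otherwise, with $\pi^i$ the tie such that $z(\pi^1\cup\dots\cup\pi^{i-1})<q(v)\le z(\pi^1\cup\dots\cup\pi^i)$, $C_v(z)(e)=z(e)$ on ties better than $\pi^i$, $C_v(z)(e)=0$ on ties worse than $\pi^i$, and $C_v(z)(e)=\min\{r,z(e)\}$ for $e\in\pi^i$, where $z(\pi^1\cup\dots\cup\pi^{i-1})+\sum_{e\in\pi^i}\min\{r,z(e)\}=q(v)$. For $z,z'$ with $C_v(z)=z$, $C_v(z')=z'$, $z\succeq_v z'$ means $C_v(z\vee z')=z$ (coordinatewise max). For stable $x,y$: $x\succeq_F y$ iff $x_f\succeq_f y_f$ for all $f\in F$; $x\succ_F y$ means $x\succeq_F y$ and $x\neq y$; $\preceq_F,\prec_F$ are the reverse relations. Known facts: $\mathcal S\ne\emptyset$, $(\mathcal S,\succeq_F)$ is a distributive lattice with greatest element $x_{\min}$ and least element $x_{\max}$;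 the set of vertices fully filled by $x$ is the same for all $x\in\mathcal S$. Active structure. Fix $x\in\mathcal S$; $V^=$ is the set of vertices fully filled by $x$, $F^==V^=\cap F$, $W^==V^=\cap W$. For $f\in F^=$ and a tie $\pi^i\in\Pi_f$, $D^i_f(x)$ is the set of edges $fw\in\pi^i$ with $x(fw)<b(fw)$ and $fw\in T_w(x)$; $\hat\Pi_f(x)$ is the set of ties $\pi^i$ with $D^i_f(x)\neq\emptyset$ such that no tie equal to or better than $\pi^i$ contains an edge $fw$ with $x(fw)<b(fw)$ and $w$ deficit; $D_f(x)=D^i_f(x)$ for the best $\pi^i\in\hat\Pi_f(x)$, and $D_f(x)=\emptyset$ if $\hat\Pi_f(x)=\emptyset$. $V^0$ is the smallest subset of $V^=$ containing every $w\in W^=$ whose $H_w(x)$ has an edge to a deficit vertex, every $f\in F^=$ with $D_f(x)=\emptyset$, and every $f\in F^=$ (resp. $w\in W^=$) such that $D_f(x)$ (resp. $H_w(x)$) contains an edge incident to a vertex of $V^0$. $F^+=F^=\setminus V^0$, $W^+=W^=\setminus V^0$. For $(\phi,\psi)\in\mathbb R^{F^+}\times\mathbb R^{W^+}$, $\Delta^{\phi,\psi}\in\mathbb R^E$ is given by $\Delta^{\phi,\psi}(fw)=\phi_f$ if $f\in F^+$ and $fw\in D_f(x)$, $-\psi_w$ if $w\in W^+$ and $fw\in H_w(x)$, and $0$ otherwise. With $h_f=|D_f(x)|$, $h_w=|H_w(x)|$ and $\varepsilon>0$, $\mathcal P^\varepsilon(x)$ is the set of $(\phi,\psi)$ satisfying: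 $h_f\phi_f-\sum(\psi_w: w\in W^+,\ fw\in H_w(x))=0$ for $f\in F^+$; $h_w\psi_w-\sum(\phi_f: f\in F^+,\ fw\in D_f(x))=0$ for $w\in W^+$; $\sum_{f\in F^+}h_f\phi_f+\sum_{w\in W^+}h_w\psi_w=\varepsilon$; $\phi\ge0,\psi\ge0$. *)

theory Defs
  imports Complex_Main "HOL-Library.Disjoint_Sets"
begin

text \<open>
  The vertices of both classes live in one type; the edge with ends \<open>f\<close> in \<open>F\<close> and \<open>w\<close> in \<open>W\<close>
  is the pair \<open>(f, w)\<close>. The list \<open>ties G v\<close> is the ordered partition of the edges at \<open>v\<close>,
  best tie first, so list index \<open>i\<close> (counted from 0) is the tie \<open>\<pi>\<close> number \<open>i + 1\<close>.
  Vectors indexed by a finite set are total real functions that vanish outside that set.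
\<close>

record 'v market =
  Fs :: "'v set"
  Ws :: "'v set"
  edges :: "('v \<times> 'v) set"
  cap :: "'v \<times> 'v \<Rightarrow> real"
  quota :: "'v \<Rightarrow> real"
  ties :: "'v \<Rightarrow> ('v \<times> 'v) set list"

type_synonym 'v evec = "'v \<times> 'v \<Rightarrow> real"

definition inc :: "'v market \<Rightarrow> 'v \<Rightarrow> ('v \<times> 'v) set" where
  "inc G v = {e \<in> edges G. fst e = v \<or> snd e = v}"

locale bipartite_market =
  fixes G :: "'v market"
  assumes finite_Fs: "finite (Fs G)"
    and finite_Ws: "finite (Ws G)"
    and disjoint_classes: "Fs G \<inter> Ws G = {}"
    and edges_bipartite: "edges G \<subseteq> Fs G \<times> Ws G"
    and cap_pos: "e \<in> edges G \<Longrightarrow> 0 < cap G e"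
    and quota_pos: "v \<in> Fs G \<union> Ws G \<Longrightarrow> 0 < quota G v"
    and ties_partition: "v \<in> Fs G \<union> Ws G \<Longrightarrow> partition_on (inc G v) (set (ties G v))"
    and ties_distinct: "v \<in> Fs G \<union> Ws G \<Longrightarrow> distinct (ties G v)"

definition norm1 :: "'v market \<Rightarrow> 'v evec \<Rightarrow> real" where
  "norm1 G a = (\<Sum>e\<in>edges G. \<bar>a e\<bar>)"

definition restr :: "'v market \<Rightarrow> 'v \<Rightarrow> 'v evec \<Rightarrow> 'v evec" where
  "restr G v a = (\<lambda>e. if e \<in> inc G v then a e else 0)"

definition first_ties :: "'v market \<Rightarrow> 'v \<Rightarrow> nat \<Rightarrow> ('v \<times> 'v) set" where
  "first_ties G v i = \<Union> (set (take i (ties G v)))"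

text \<open>Meaningful when \<open>z\<close> is nonnegative and the sum of \<open>z\<close> over the edges at \<open>v\<close> is at least
  the quota of \<open>v\<close>; the index is then unique.\<close>

definition crit_index :: "'v market \<Rightarrow> 'v \<Rightarrow> 'v evec \<Rightarrow> nat" where
  "crit_index G v z = (THE i. i < length (ties G v) \<and>
     sum z (first_ties G v i) < quota G v \<and> quota G v \<le> sum z (first_ties G v (Suc i)))"

definition crit_tie :: "'v market \<Rightarrow> 'v \<Rightarrow> 'v evec \<Rightarrow> ('v \<times> 'v) set" where
  "crit_tie G v z = ties G v ! crit_index G v z"

definition end_edges :: "'v market \<Rightarrow> 'v \<Rightarrow> 'v evec \<Rightarrow> ('v \<times> 'v) set" where
  "end_edges G v z = \<Union> (set (drop (Suc (crit_index G v z)) (ties G v)))"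


subsection \<open>Stable assignments\<close>

definition assignment :: "'v market \<Rightarrow> 'v evec \<Rightarrow> bool" where
  "assignment G x \<longleftrightarrow>
     (\<forall>e. e \<notin> edges G \<longrightarrow> x e = 0) \<and>
     (\<forall>e\<in>edges G. 0 \<le> x e \<and> x e \<le> cap G e) \<and>
     (\<forall>v\<in>Fs G \<union> Ws G. sum x (inc G v) \<le> quota G v)"

definition filled :: "'v market \<Rightarrow> 'v evec \<Rightarrow> 'v \<Rightarrow> bool" where
  "filled G x v \<longleftrightarrow> sum x (inc G v) = quota G v"

definition deficit :: "'v market \<Rightarrow> 'v evec \<Rightarrow> 'v \<Rightarrow> bool" where
  "deficit G x v \<longleftrightarrow> sum x (inc G v) < quota G v"

definition head :: "'v market \<Rightarrow> 'v evec \<Rightarrow> 'v \<Rightarrow> ('v \<times> 'v) set" where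
  "head G x v =
     (if filled G x v then {e \<in> crit_tie G v x. \<forall>e'\<in>crit_tie G v x. x e' \<le> x e} else {})"

definition tail :: "'v market \<Rightarrow> 'v evec \<Rightarrow> 'v \<Rightarrow> ('v \<times> 'v) set" where
  "tail G x v =
     (if filled G x v then inc G v - (head G x v \<union> end_edges G v x) else inc G v)"

definition blocking :: "'v market \<Rightarrow> 'v evec \<Rightarrow> 'v \<times> 'v \<Rightarrow> bool" where
  "blocking G x e \<longleftrightarrow>
     e \<in> edges G \<and> x e < cap G e \<and> e \<in> tail G x (fst e) \<inter> tail G x (snd e)"

definition stable_set :: "'v market \<Rightarrow> 'v evec set" where
  "stable_set G = {x. assignment G x \<and> (\<forall>e. \<not> blocking G x e)}"


subsection \<open>Choice functions and preferences\<close>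

text \<open>The cutting height \<open>r\<close> need not be unique (namely when nothing has to be cut off in the
  critical tie), but all admissible \<open>r\<close> give the same values \<open>min r (z e)\<close> on that tie.\<close>

definition choice :: "'v market \<Rightarrow> 'v \<Rightarrow> 'v evec \<Rightarrow> 'v evec" where
  "choice G v z =
     (if sum z (inc G v) \<le> quota G v then z
      else (let i = crit_index G v z;
                r = (SOME r. sum z (first_ties G v i) + (\<Sum>e\<in>crit_tie G v z. min r (z e)) = quota G v)
            in (\<lambda>e. if e \<in> first_ties G v i then z e
                    else if e \<in> crit_tie G v z then min r (z e)
                    else 0)))"

definition acceptable :: "'v market \<Rightarrow> 'v \<Rightarrow> 'v evec \<Rightarrow> bool" where
  "acceptable G v z \<longleftrightarrow>
     (\<forall>e. e \<notin> inc G v \<longrightarrow> z e = 0) \<and> (\<forall>e\<in>inc G v. 0 \<le> z e \<and> z e \<le> cap G e) \<and>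
     choice G v z = z"

definition pref :: "'v market \<Rightarrow> 'v \<Rightarrow> 'v evec \<Rightarrow> 'v evec \<Rightarrow> bool" where
  "pref G v z z' \<longleftrightarrow>
     acceptable G v z \<and> acceptable G v z' \<and> choice G v (\<lambda>e. max (z e) (z' e)) = z"

text \<open>The first argument is the one preferred by \<open>F\<close>.\<close>

definition prefF :: "'v market \<Rightarrow> 'v evec \<Rightarrow> 'v evec \<Rightarrow> bool" where
  "prefF G x y \<longleftrightarrow> x \<in> stable_set G \<and> y \<in> stable_set G \<and>
     (\<forall>f\<in>Fs G. pref G f (restr G f x) (restr G f y))"

definition sprefF :: "'v market \<Rightarrow> 'v evec \<Rightarrow> 'v evec \<Rightarrow> bool" where
  "sprefF G x y \<longleftrightarrow> prefF G x y \<and> x \<noteq> y"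

text \<open>The least element for \<open>prefF\<close>, that is, the worst stable assignment for \<open>F\<close>.\<close>

definition x_max :: "'v market \<Rightarrow> 'v evec" where
  "x_max G = (THE y. y \<in> stable_set G \<and> (\<forall>z\<in>stable_set G. prefF G z y))"


subsection \<open>Active structure\<close>

definition Feq :: "'v market \<Rightarrow> 'v evec \<Rightarrow> 'v set" where
  "Feq G x = {f \<in> Fs G. filled G x f}"

definition Weq :: "'v market \<Rightarrow> 'v evec \<Rightarrow> 'v set" where
  "Weq G x = {w \<in> Ws G. filled G x w}"

definition Dtie :: "'v market \<Rightarrow> 'v evec \<Rightarrow> 'v \<Rightarrow> nat \<Rightarrow> ('v \<times> 'v) set" where
  "Dtie G x f i = {e \<in> ties G f ! i. x e < cap G e \<and> e \<in> tail G x (snd e)}"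

text \<open>The set of ties \<open>\<Pi>\<close>-hat of \<open>f\<close>, represented by their list indices.\<close>

definition cand_ties :: "'v market \<Rightarrow> 'v evec \<Rightarrow> 'v \<Rightarrow> nat set" where
  "cand_ties G x f = {i. i < length (ties G f) \<and> Dtie G x f i \<noteq> {} \<and>
     \<not> (\<exists>j\<le>i. \<exists>e\<in>ties G f ! j. x e < cap G e \<and> deficit G x (snd e))}"

definition D :: "'v market \<Rightarrow> 'v evec \<Rightarrow> 'v \<Rightarrow> ('v \<times> 'v) set" where
  "D G x f = (if cand_ties G x f = {} then {} else Dtie G x f (LEAST i. i \<in> cand_ties G x f))"

inductive_set V0 :: "'v market \<Rightarrow> 'v evec \<Rightarrow> 'v set" for G :: "'v market" and x :: "'v evec" where
  W_deficit: "w \<in> Weq G x \<Longrightarrow> (f, w) \<in> head G x w \<Longrightarrow> deficit G x f \<Longrightarrow> w \<in> V0 G x"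
| F_empty: "f \<in> Feq G x \<Longrightarrow> D G x f = {} \<Longrightarrow> f \<in> V0 G x"
| F_step: "f \<in> Feq G x \<Longrightarrow> (f, w) \<in> D G x f \<Longrightarrow> w \<in> V0 G x \<Longrightarrow> f \<in> V0 G x"
| W_step: "w \<in> Weq G x \<Longrightarrow> (f, w) \<in> head G x w \<Longrightarrow> f \<in> V0 G x \<Longrightarrow> w \<in> V0 G x"

definition Fplus :: "'v market \<Rightarrow> 'v evec \<Rightarrow> 'v set" where
  "Fplus G x = Feq G x - V0 G x"

definition Wplus :: "'v market \<Rightarrow> 'v evec \<Rightarrow> 'v set" where
  "Wplus G x = Weq G x - V0 G x"

definition Delta :: "'v market \<Rightarrow> 'v evec \<Rightarrow> ('v \<Rightarrow> real) \<Rightarrow> ('v \<Rightarrow> real) \<Rightarrow> 'v evec" where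
  "Delta G x \<phi> \<psi> = (\<lambda>(f, w).
     if f \<in> Fplus G x \<and> (f, w) \<in> D G x f then \<phi> f
     else if w \<in> Wplus G x \<and> (f, w) \<in> head G x w then - \<psi> w
     else 0)"

definition P_eps :: "'v market \<Rightarrow> 'v evec \<Rightarrow> real \<Rightarrow> (('v \<Rightarrow> real) \<times> ('v \<Rightarrow> real)) set" where
  "P_eps G x \<epsilon> = {(\<phi>, \<psi>).
     (\<forall>v. v \<notin> Fplus G x \<longrightarrow> \<phi> v = 0) \<and> (\<forall>v. v \<notin> Wplus G x \<longrightarrow> \<psi> v = 0) \<and>
     (\<forall>f\<in>Fplus G x.
        real (card (D G x f)) * \<phi> f - (\<Sum>w | w \<in> Wplus G x \<and> (f, w) \<in> head G x w. \<psi> w) = 0) \<and>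
     (\<forall>w\<in>Wplus G x.
        real (card (head G x w)) * \<psi> w - (\<Sum>f | f \<in> Fplus G x \<and> (f, w) \<in> D G x f. \<phi> f) = 0) \<and>
     (\<Sum>f\<in>Fplus G x. real (card (D G x f)) * \<phi> f)
       + (\<Sum>w\<in>Wplus G x. real (card (head G x w)) * \<psi> w) = \<epsilon> \<and>
     (\<forall>f\<in>Fplus G x. 0 \<le> \<phi> f) \<and> (\<forall>w\<in>Wplus G x. 0 \<le> \<psi> w)}"

definition X_eps :: "'v market \<Rightarrow> 'v evec \<Rightarrow> real \<Rightarrow> 'v evec set" where
  "X_eps G x \<epsilon> =
     {x' \<in> stable_set G. sprefF G x x' \<and> norm1 G (\<lambda>e. x' e - x e) = \<epsilon>}"

end

theory Submission
  imports Defs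
begin

text \<open>
  An assignment \<open>x\<close> is at least as good as \<open>y\<close> for a vertex iff \<open>y \<le> x\<close> on the tail of \<open>x\<close> there.
  From this one reads off that the preferences of the two classes are opposite, that comparable
  stable assignments fill every vertex equally, and that an edge on which a worse stable \<open>y\<close>
  exceeds \<open>x\<close> lies in the tail of \<open>x\<close> at its end in \<open>W\<close> and in a candidate tie at its end in \<open>F\<close>.
  If \<open>y\<close> is within the gaps of \<open>x\<close>, then at a vertex \<open>f\<close> touched by \<open>y - x\<close> the increasing edges
  are exactly those of \<open>D G x f\<close>, which form the head of \<open>y\<close> and so increase by a common amount
  \<open>\<phi> f\<close>; dually at \<open>w\<close> the edges of \<open>head G x w\<close> decrease by a common amount \<open>\<psi> w\<close>. Conversely
  a small step along a solution of the balance equations cannot create a blocking edge.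
  For (b), the vertices touched by \<open>y - x\<close> are closed under the active structure even when
  \<open>y\<close> is far away, so there is a balanced step supported on them, and it does not overshoot \<open>y\<close>.
\<close>

text \<open>The two classes react differently to a small step. At \<open>w\<close> the critical tie
  stays and only values inside it move; at \<open>f\<close> the critical tie may jump to a worse
  one, that of \<open>D G x f\<close>, on which \<open>x\<close> may vanish. So at \<open>f\<close>
  closeness alone is not enough, and the minimality of the candidate tie has to control the edges.

  The step is therefore produced abstractly. If \<open>\<pi> v\<close> stands for \<open>h_v\<close>
  times the variable at \<open>v\<close>, the balance equations say that mass sent out in equal
  shares along the active edges is restored at every vertex, which is stationarity of a finite
  Markov chain. Comparing the new assignment with \<open>y\<close> then needs care only on
  decreasing edges, because an edge on which \<open>y\<close> exceeds \<open>x\<close> is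
  automatically outside the tail of the new assignment at \<open>f\<close>. This is why only the
  support of \<open>\<psi>\<close> is recorded.\<close>

text \<open>The state \<open>k\<close> is eliminated by watching the chain only while it is outside \<open>k\<close>.\<close>

lemma stationary_measure_exists:
  fixes p :: "'a \<Rightarrow> 'a \<Rightarrow> real"
  assumes "finite S" "S \<noteq> {}" "\<And>i j. i \<in> S \<Longrightarrow> j \<in> S \<Longrightarrow> 0 \<le> p i j"
    "\<And>i. i \<in> S \<Longrightarrow> (\<Sum>j\<in>S. p i j) = 1"
  shows "\<exists>\<pi>. (\<forall>i\<in>S. 0 \<le> \<pi> i) \<and> 0 < sum \<pi> S \<and> (\<forall>j\<in>S. (\<Sum>i\<in>S. \<pi> i * p i j) = \<pi> j)"
  using assms
proof (induction S arbitrary: p rule: finite_ne_induct)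
  case (singleton k)
  then show ?case by (intro exI[of _ "\<lambda>_. 1"]) simp
next
  case (insert k S)
  have row: "p i k + (\<Sum>j\<in>S. p i j) = 1" if "i \<in> insert k S" for i
    using insert.prems(2)[OF that] insert.hyps by simp
  have nn: "0 \<le> (\<Sum>j\<in>S. p k j)" using insert.prems(1) by (intro sum_nonneg) auto
  show ?case
  proof (cases "p k k = 1")
    \<comment> \<open>Here \<open>k\<close> is absorbing, and the point mass at \<open>k\<close> is
      stationary.\<close>
    case True
    then have "(\<Sum>j\<in>S. p k j) = 0" using row[of k] by simp
    then have "\<forall>j\<in>S. p k j = 0"
      using insert.hyps insert.prems(1) by (subst (asm) sum_nonneg_eq_0_iff) auto
    moreover have "i \<noteq> k" if "i \<in> S" for i using that insert.hyps by blast
    then have "(\<Sum>i\<in>S. (if i = k then 1 else 0) * p i j) = 0" "(\<Sum>i\<in>S. if i = k then 1 else 0 :: real) = 0" for j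
      by (auto intro!: sum.neutral)
    ultimately show ?thesis
      using insert.hyps True by (intro exI[of _ "\<lambda>i. if i = k then 1 else 0"]) auto
  next
    case False
    define a where "a = 1 - p k k"
    have a: "0 < a" "(\<Sum>j\<in>S. p k j) = a" using False row[of k] nn by (auto simp: a_def)
    \<comment> \<open>An excursion through \<open>k\<close> returns to \<open>j\<close> with
      probability \<open>p k j / a\<close>: the repeated stays at \<open>k\<close> form a geometric
      series with sum \<open>1 / a\<close>.\<close>
    define q where "q i j = p i j + p i k * p k j / a" for i j
    have "(\<Sum>j\<in>S. q i j) = 1" if "i \<in> S" for i
    proof -
      have "(\<Sum>j\<in>S. q i j) = (\<Sum>j\<in>S. p i j) + p i k / a * (\<Sum>j\<in>S. p k j)"
        by (simp add: q_def sum.distrib sum_distrib_left)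
      then show ?thesis using a row[of i] that by simp
    qed
    moreover have "0 \<le> q i j" if "i \<in> S" "j \<in> S" for i j
      using insert.prems(1) that a by (simp add: q_def)
    ultimately obtain \<pi> where \<pi>: "\<forall>i\<in>S. 0 \<le> \<pi> i" "0 < sum \<pi> S"
      "\<forall>j\<in>S. (\<Sum>i\<in>S. \<pi> i * q i j) = \<pi> j"
      using insert.IH[of q] by blast
    \<comment> \<open>The mass at \<open>k\<close> is forced by stationarity there: outflow
      \<open>m * a\<close> equals inflow from \<open>S\<close>.\<close>
    define m where "m = (\<Sum>i\<in>S. \<pi> i * p i k) / a"
    define \<rho> where "\<rho> i = (if i = k then m else \<pi> i)" for i
    have \<rho>: "\<rho> k = m" "\<And>i. i \<in> S \<Longrightarrow> \<rho> i = \<pi> i" using insert.hyps by (auto simp: \<rho>_def)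
    have m: "0 \<le> m" using \<pi>(1) insert.prems(1) a unfolding m_def by (intro divide_nonneg_pos sum_nonneg) auto
    have s: "(\<Sum>i\<in>insert k S. \<rho> i * p i j) = m * p k j + (\<Sum>i\<in>S. \<pi> i * p i j)" for j
      using insert.hyps \<rho> by (simp cong: sum.cong)
    have "(\<Sum>i\<in>insert k S. \<rho> i * p i j) = \<rho> j" if "j \<in> insert k S" for j
    proof (cases "j = k")
      case True
      have "(\<Sum>i\<in>S. \<pi> i * p i k) = m * a" using a by (simp add: m_def)
      then show ?thesis unfolding s using True \<rho>(1) by (simp add: a_def algebra_simps)
    next
      case False
      have "m * p k j + (\<Sum>i\<in>S. \<pi> i * p i j) = (\<Sum>i\<in>S. \<pi> i * q i j)"
        unfolding m_def q_def
        by (simp add: sum_divide_distrib sum_distrib_right sum.distrib distrib_left mult.assoc)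
      then show ?thesis unfolding s using \<pi>(3) False that \<rho>(2) by simp
    qed
    moreover have "sum \<rho> (insert k S) = m + sum \<pi> S"
      using insert.hyps \<rho> by (simp cong: sum.cong)
    ultimately show ?thesis
      using m \<pi> \<rho> by (intro exI[of _ \<rho>]) auto
  qed
qed

context bipartite_market
begin

subsection \<open>Ranks and critical ties\<close>

text \<open>With ranks, unions of ties become sets cut out by inequalities, and sums over them
  compare by monotonicity. Smaller is better; the value is meaningful only on
  \<open>inc G v\<close>.\<close>

definition rk :: "'v \<Rightarrow> 'v \<times> 'v \<Rightarrow> nat" where
  "rk v e = (THE i. i < length (ties G v) \<and> e \<in> ties G v ! i)"

lemma finite_edges: "finite (edges G)"
  using edges_bipartite finite_Fs finite_Ws finite_cartesian_product finite_subset by blast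

lemma finite_inc [simp]: "finite (inc G v)"
  using finite_edges by (simp add: inc_def)

lemma inc_edge: "e \<in> inc G v \<Longrightarrow> e \<in> edges G"
  by (simp add: inc_def)

lemma edge_vertices: "e \<in> edges G \<Longrightarrow> fst e \<in> Fs G \<and> snd e \<in> Ws G"
  using edges_bipartite by auto

lemma edge_inc: "e \<in> edges G \<Longrightarrow> e \<in> inc G (fst e) \<and> e \<in> inc G (snd e)"
  by (simp add: inc_def)

lemma inc_F: "f \<in> Fs G \<Longrightarrow> e \<in> inc G f \<Longrightarrow> fst e = f"
  using edge_vertices disjoint_classes by (fastforce simp: inc_def)

lemma inc_W: "w \<in> Ws G \<Longrightarrow> e \<in> inc G w \<Longrightarrow> snd e = w"
  using edge_vertices disjoint_classes by (fastforce simp: inc_def)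

lemma rk_iff:
  assumes v: "v \<in> Fs G \<union> Ws G" and e: "e \<in> inc G v"
  shows "rk v e = i \<longleftrightarrow> i < length (ties G v) \<and> e \<in> ties G v ! i"
proof -
  have part: "\<Union> (set (ties G v)) = inc G v" "disjoint (set (ties G v))"
    using ties_partition[OF v] by (auto simp: partition_on_def)
  have uniq: "i = j" if "i < length (ties G v)" "e \<in> ties G v ! i"
    "j < length (ties G v)" "e \<in> ties G v ! j" for i j
  proof -
    have "ties G v ! i = ties G v ! j"
      using part(2) that unfolding disjoint_def by (metis IntI empty_iff nth_mem)
    then show ?thesis
      using that ties_distinct[OF v] nth_eq_iff_index_eq by blast
  qed
  obtain j where "j < length (ties G v)" "e \<in> ties G v ! j"
    using e part(1) by (metis UnionE in_set_conv_nth)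
  then have "\<exists>!j. j < length (ties G v) \<and> e \<in> ties G v ! j"
    using uniq by blast
  from theI'[OF this] show ?thesis
    using uniq unfolding rk_def by blast
qed

lemma rk_less: "v \<in> Fs G \<union> Ws G \<Longrightarrow> e \<in> inc G v \<Longrightarrow> rk v e < length (ties G v)"
  using rk_iff by blast

lemma tie_subset_inc:
  assumes "v \<in> Fs G \<union> Ws G" "i < length (ties G v)"
  shows "ties G v ! i \<subseteq> inc G v"
  using ties_partition[OF assms(1)] assms(2) by (auto simp: partition_on_def)

lemma tie_eq:
  assumes "v \<in> Fs G \<union> Ws G" "i < length (ties G v)"
  shows "ties G v ! i = {e \<in> inc G v. rk v e = i}"
  using rk_iff[OF assms(1)] tie_subset_inc[OF assms] assms(2) by blast

lemma first_ties_eq: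
  assumes v: "v \<in> Fs G \<union> Ws G" and i: "i \<le> length (ties G v)"
  shows "first_ties G v i = {e \<in> inc G v. rk v e < i}"
proof -
  have "first_ties G v i = (\<Union>j<i. ties G v ! j)"
    using nth_image[OF i] unfolding first_ties_def by (simp add: atLeast0LessThan)
  also have "\<dots> = (\<Union>j<i. {e \<in> inc G v. rk v e = j})"
    using tie_eq[OF v] i by simp
  finally show ?thesis by auto
qed

lemma end_edges_eq:
  assumes v: "v \<in> Fs G \<union> Ws G"
  shows "end_edges G v z = {e \<in> inc G v. crit_index G v z < rk v e}"
proof (intro equalityI subsetI)
  fix e assume "e \<in> end_edges G v z"
  then obtain k where "Suc (crit_index G v z) + k < length (ties G v)"
    "e \<in> ties G v ! (Suc (crit_index G v z) + k)"
    unfolding end_edges_def by (auto simp: in_set_conv_nth less_diff_conv add.commute)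
  then show "e \<in> {e \<in> inc G v. crit_index G v z < rk v e}"
    using tie_eq[OF v] by auto
next
  fix e assume e: "e \<in> {e \<in> inc G v. crit_index G v z < rk v e}"
  let ?k = "rk v e - Suc (crit_index G v z)"
  have "rk v e < length (ties G v)" "e \<in> ties G v ! rk v e"
    using rk_iff[OF v, of e "rk v e"] e by auto
  then have "drop (Suc (crit_index G v z)) (ties G v) ! ?k = ties G v ! rk v e"
    "?k < length (drop (Suc (crit_index G v z)) (ties G v))"
    using e by auto
  then show "e \<in> end_edges G v z"
    using \<open>e \<in> ties G v ! rk v e\<close> unfolding end_edges_def by (metis UnionI nth_mem)
qed

abbreviation cri :: "'v evec \<Rightarrow> 'v \<Rightarrow> nat" where
  "cri z v \<equiv> crit_index G v z"

text \<open>Prefix sums of a nonnegative \<open>z\<close> are monotone in the rank, so they cross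
  the quota only once. The length bound comes for free: past the last tie the two sums
  coincide.\<close>

lemma crit_index_eqI:
  assumes v: "v \<in> Fs G \<union> Ws G" and nn: "\<forall>e\<in>inc G v. 0 \<le> z e"
    and i: "sum z {e \<in> inc G v. rk v e < i} < quota G v"
    "quota G v \<le> sum z {e \<in> inc G v. rk v e \<le> i}"
  shows "i < length (ties G v)" "cri z v = i"
proof -
  show len: "i < length (ties G v)"
  proof (rule ccontr)
    assume "\<not> i < length (ties G v)"
    then have "{e \<in> inc G v. rk v e < i} = {e \<in> inc G v. rk v e \<le> i}"
      using rk_less[OF v] by fastforce
    then show False using i by simp
  qed
  have eq: "j < length (ties G v) \<and>
     sum z (first_ties G v j) < quota G v \<and> quota G v \<le> sum z (first_ties G v (Suc j)) \<longleftrightarrow>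
     j < length (ties G v) \<and> sum z {e \<in> inc G v. rk v e < j} < quota G v
     \<and> quota G v \<le> sum z {e \<in> inc G v. rk v e \<le> j}" for j
    using first_ties_eq[OF v] by (auto simp: less_Suc_eq_le)
  show "cri z v = i"
    unfolding crit_index_def eq
  proof (rule the_equality)
    fix j assume j: "j < length (ties G v) \<and> sum z {e \<in> inc G v. rk v e < j} < quota G v
     \<and> quota G v \<le> sum z {e \<in> inc G v. rk v e \<le> j}"
    have mono: "sum z {e \<in> inc G v. rk v e \<le> k} \<le> sum z {e \<in> inc G v. rk v e < l}" if "k < l" for k l
      using that nn by (intro sum_mono2) auto
    show "j = i" using i j mono[of i j] mono[of j i] by (cases j i rule: linorder_cases) auto
  qed (use i len in auto)
qed

lemma crit_index_props:
  assumes v: "v \<in> Fs G \<union> Ws G" and nn: "\<forall>e\<in>inc G v. 0 \<le> z e"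
    and q: "quota G v \<le> sum z (inc G v)"
  shows "cri z v < length (ties G v)"
    "sum z {e \<in> inc G v. rk v e < cri z v} < quota G v"
    "quota G v \<le> sum z {e \<in> inc G v. rk v e \<le> cri z v}"
proof -
  define P where "P i \<longleftrightarrow> quota G v \<le> sum z {e \<in> inc G v. rk v e \<le> i}" for i
  have "{e \<in> inc G v. rk v e \<le> length (ties G v)} = inc G v"
    using rk_less[OF v] by fastforce
  then have ex: "P (length (ties G v))" using q by (simp add: P_def)
  define i where "i = (LEAST i. P i)"
  have Pi: "P i" unfolding i_def by (rule LeastI[where P = P, OF ex])
  have "sum z {e \<in> inc G v. rk v e < i} < quota G v"
  proof (cases i)
    \<comment> \<open>The empty sum is below the quota because quotas are positive.\<close>
    case 0
    then show ?thesis using quota_pos[OF v] by simp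
  next
    case (Suc j)
    then have "\<not> P j" unfolding i_def by (metis lessI not_less_Least)
    then show ?thesis using Suc by (simp add: P_def less_Suc_eq_le)
  qed
  then show "cri z v < length (ties G v)"
    "sum z {e \<in> inc G v. rk v e < cri z v} < quota G v"
    "quota G v \<le> sum z {e \<in> inc G v. rk v e \<le> cri z v}"
    using crit_index_eqI[OF v nn, where i = i] Pi unfolding P_def by auto
qed

lemma assignment_nonneg: "assignment G x \<Longrightarrow> 0 \<le> x e"
  unfolding assignment_def by (metis order_refl)

lemma assignment_le_cap: "assignment G x \<Longrightarrow> e \<in> edges G \<Longrightarrow> x e \<le> cap G e"
  unfolding assignment_def by auto

lemma assignment_zero: "assignment G x \<Longrightarrow> e \<notin> edges G \<Longrightarrow> x e = 0"
  unfolding assignment_def by blast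

lemma assignment_sum_le: "assignment G x \<Longrightarrow> v \<in> Fs G \<union> Ws G \<Longrightarrow> sum x (inc G v) \<le> quota G v"
  unfolding assignment_def by auto

lemma deficit_iff: "assignment G x \<Longrightarrow> v \<in> Fs G \<union> Ws G \<Longrightarrow> deficit G x v \<longleftrightarrow> \<not> filled G x v"
  using assignment_sum_le unfolding deficit_def filled_def by force

lemma crit_tie_eq:
  assumes "v \<in> Fs G \<union> Ws G" "\<forall>e\<in>inc G v. 0 \<le> z e" "quota G v \<le> sum z (inc G v)"
  shows "crit_tie G v z = {e \<in> inc G v. rk v e = cri z v}"
  unfolding crit_tie_def using tie_eq[OF assms(1) crit_index_props(1)[OF assms]] .

text \<open>The ties up to the critical one already use up the quota, so a positive value beyond it
  would overfill \<open>v\<close>.\<close>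

lemma zero_beyond_crit:
  assumes v: "v \<in> Fs G \<union> Ws G" and nn: "\<forall>e\<in>inc G v. 0 \<le> x e" and fl: "filled G x v"
    and e: "e \<in> inc G v" "cri x v < rk v e"
  shows "x e = 0"
proof (rule ccontr)
  assume "x e \<noteq> 0"
  then have "x e > 0" using nn e by (simp add: order_less_le)
  then have "sum x {e \<in> inc G v. rk v e \<le> cri x v} < sum x (inc G v)"
    using e nn by (intro sum_strict_mono2[of _ _ e]) auto
  moreover have "quota G v \<le> sum x {e \<in> inc G v. rk v e \<le> cri x v}"
    using crit_index_props(3)[OF v nn] fl by (simp add: filled_def)
  ultimately show False using fl by (simp add: filled_def)
qed

lemma head_iff:
  assumes "v \<in> Fs G \<union> Ws G" "\<forall>e\<in>inc G v. 0 \<le> x e"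
  shows "e \<in> head G x v \<longleftrightarrow> filled G x v \<and> e \<in> inc G v \<and> rk v e = cri x v
    \<and> (\<forall>e'\<in>inc G v. rk v e' = cri x v \<longrightarrow> x e' \<le> x e)"
  using crit_tie_eq[OF assms] by (auto simp: head_def filled_def)

lemma tail_iff:
  assumes "v \<in> Fs G \<union> Ws G" "\<forall>e\<in>inc G v. 0 \<le> x e"
  shows "e \<in> tail G x v \<longleftrightarrow> e \<in> inc G v \<and> (\<not> filled G x v \<or> rk v e < cri x v
    \<or> (rk v e = cri x v \<and> (\<exists>e'\<in>inc G v. rk v e' = cri x v \<and> x e < x e')))"
proof (cases "filled G x v")
  case True
  then show ?thesis
    unfolding tail_def end_edges_eq[OF assms(1)] using head_iff[OF assms, where e = e]
    by (cases "rk v e" "cri x v" rule: linorder_cases) (auto simp: not_le)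
qed (simp add: tail_def)

lemma crit_cong:
  assumes v: "v \<in> Fs G \<union> Ws G" and eq: "\<forall>e\<in>inc G v. x e = y e"
  shows "cri x v = cri y v"
proof -
  have "sum x (first_ties G v i) = sum y (first_ties G v i)" if "i \<le> length (ties G v)" for i
    using first_ties_eq[OF v that] eq by (intro sum.cong) auto
  then have "i < length (ties G v) \<and>
     sum x (first_ties G v i) < quota G v \<and> quota G v \<le> sum x (first_ties G v (Suc i)) \<longleftrightarrow>
     i < length (ties G v) \<and>
     sum y (first_ties G v i) < quota G v \<and> quota G v \<le> sum y (first_ties G v (Suc i))" for i
    by (cases "i < length (ties G v)") simp_all
  then show ?thesis unfolding crit_index_def by presburger
qed

lemma filled_cong: "\<forall>e\<in>inc G v. x e = y e \<Longrightarrow> filled G x v \<longleftrightarrow> filled G y v"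
  unfolding filled_def by (simp cong: sum.cong)

text \<open>Serves vertices at which two assignments agree: there the consequences of stability
  carry over from one assignment to the other.\<close>

lemma tail_cong:
  assumes v: "v \<in> Fs G \<union> Ws G" and eq: "\<forall>e\<in>inc G v. x e = y e"
    and nn: "\<forall>e\<in>inc G v. 0 \<le> x e"
  shows "tail G x v = tail G y v"
proof -
  have nn': "\<forall>e\<in>inc G v. 0 \<le> y e" using eq nn by force
  show ?thesis
    unfolding set_eq_iff tail_iff[OF v nn] tail_iff[OF v nn'] crit_cong[OF v eq] filled_cong[OF eq]
    using eq by auto
qed


subsection \<open>Preferences\<close>

text \<open>Intermediate value theorem in the height \<open>r\<close>.\<close>

lemma cut_height_exists:
  fixes z :: "'a \<Rightarrow> real"
  assumes "finite T" "\<And>e. e \<in> T \<Longrightarrow> 0 \<le> z e" "a \<ge> 0" "a \<le> sum z T"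
  shows "\<exists>r. (\<Sum>e\<in>T. min r (z e)) = a"
proof -
  \<comment> \<open>\<open>sum z T\<close> bounds each single \<open>z e\<close>, so at this height
    nothing is cut.\<close>
  let ?M = "sum z T"
  have "(\<Sum>e\<in>T. min 0 (z e)) = 0" using assms(2) by (intro sum.neutral) auto
  moreover have "(\<Sum>e\<in>T. min ?M (z e)) = sum z T"
    using member_le_sum[of _ T z] assms(1,2) by (intro sum.cong) (auto simp: min_absorb2)
  moreover have "continuous_on {0..?M} (\<lambda>r. \<Sum>e\<in>T. min r (z e))"
    by (intro continuous_intros)
  ultimately show ?thesis
    using IVT'[of "\<lambda>r. \<Sum>e\<in>T. min r (z e)" 0 a ?M] assms by (auto intro: sum_nonneg)
qed

text \<open>All terms are monotone in the height, so equal sums force equal terms. This makes the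
  arbitrary height picked in \<open>choice\<close> harmless.\<close>

lemma cut_height_unique:
  fixes z :: "'a \<Rightarrow> real"
  assumes "finite T" "(\<Sum>e\<in>T. min r (z e)) = (\<Sum>e\<in>T. min s (z e))" "e \<in> T"
  shows "min r (z e) = min s (z e)"
proof (cases "r \<le> s")
  case True
  then show ?thesis using assms by (intro sum_mono_inv[of "\<lambda>e. min r (z e)" T]) auto
next
  case False
  then show ?thesis using assms by (intro sum_mono_inv[of "\<lambda>e. min s (z e)" T, symmetric]) auto
qed

lemma choice_overfull:
  assumes v: "v \<in> Fs G \<union> Ws G" and nn: "\<forall>e\<in>inc G v. 0 \<le> z e"
    and q: "quota G v < sum z (inc G v)"
  obtains r where
    "sum z {e \<in> inc G v. rk v e < cri z v} + (\<Sum>e | e \<in> inc G v \<and> rk v e = cri z v. min r (z e)) = quota G v"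
    "choice G v z = (\<lambda>e. if e \<in> inc G v then
       (if rk v e < cri z v then z e else if rk v e = cri z v then min r (z e) else 0) else 0)"
proof -
  let ?c = "cri z v"
  have props: "?c < length (ties G v)" "sum z {e \<in> inc G v. rk v e < ?c} < quota G v"
    "quota G v \<le> sum z {e \<in> inc G v. rk v e \<le> ?c}"
    using crit_index_props[OF v nn] q by auto
  have ft: "first_ties G v ?c = {e \<in> inc G v. rk v e < ?c}"
    using first_ties_eq[OF v] props(1) by simp
  have ct: "crit_tie G v z = {e \<in> inc G v. rk v e = ?c}"
    using crit_tie_eq[OF v nn] q by simp
  have split: "sum z {e \<in> inc G v. rk v e \<le> ?c}
    = sum z {e \<in> inc G v. rk v e < ?c} + sum z {e \<in> inc G v. rk v e = ?c}"
    by (subst sum.union_disjoint[symmetric]) (auto intro!: sum.cong)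
  have "\<exists>r. (\<Sum>e | e \<in> inc G v \<and> rk v e = ?c. min r (z e))
    = quota G v - sum z {e \<in> inc G v. rk v e < ?c}"
    using props split nn by (intro cut_height_exists) auto
  then have ex: "\<exists>r. sum z {e \<in> inc G v. rk v e < ?c}
    + (\<Sum>e | e \<in> inc G v \<and> rk v e = ?c. min r (z e)) = quota G v"
    by (simp add: eq_diff_eq add.commute)
  show ?thesis
    apply (rule that[OF someI_ex[OF ex]])
    using q unfolding choice_def Let_def ft ct by (auto simp: fun_eq_iff)
qed

text \<open>By \<open>pref_restr_iff\<close> this replaces \<open>pref\<close>, and the choice
  function disappears from the rest of the argument. Nothing is required outside the tail of
  \<open>x\<close>, where any excess of \<open>y\<close> would be cut off by the choice.\<close>

definition dom :: "'v \<Rightarrow> 'v evec \<Rightarrow> 'v evec \<Rightarrow> bool" where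
  "dom v x y \<longleftrightarrow> (\<forall>e\<in>tail G x v. y e \<le> x e)"

text \<open>Choosing from the join \<open>m\<close> returns \<open>x\<close> iff the join adds
  nothing where \<open>x\<close> is not limited by a cut. The cases are whether \<open>m\<close>
  exceeds the quota; if so, the cut happens in the critical tie of \<open>x\<close> and at the level
  of its head.\<close>

lemma pref_restr_iff:
  assumes v: "v \<in> Fs G \<union> Ws G" and x: "assignment G x" and y: "assignment G y"
  shows "pref G v (restr G v x) (restr G v y) \<longleftrightarrow> dom v x y"
proof -
  define m where "m = (\<lambda>e. max (restr G v x e) (restr G v y e))"
  have acc: "acceptable G v (restr G v z)" if "assignment G z" for z
  proof -
    have "sum (restr G v z) (inc G v) = sum z (inc G v)"
      by (simp add: restr_def)
    then show ?thesis
      using assignment_sum_le[OF that v] assignment_nonneg[OF that] assignment_le_cap[OF that]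
      by (auto simp: acceptable_def choice_def restr_def inc_edge)
  qed
  have pref: "pref G v (restr G v x) (restr G v y) \<longleftrightarrow> choice G v m = restr G v x"
    using acc[OF x] acc[OF y] by (simp add: pref_def m_def)
  have m_in: "m e = max (x e) (y e)" if "e \<in> inc G v" for e
    using that by (simp add: m_def restr_def)
  have m_out: "m e = 0" if "e \<notin> inc G v" for e
    using that by (simp add: m_def restr_def)
  have nnm: "\<forall>e\<in>inc G v. 0 \<le> m e"
    using m_in assignment_nonneg[OF x] by (simp add: max.coboundedI1)
  have nnx: "\<forall>e\<in>inc G v. 0 \<le> x e" using assignment_nonneg[OF x] by simp
  show ?thesis
  proof (cases "sum m (inc G v) \<le> quota G v")
    case True
    then have ch: "choice G v m = m" by (simp add: choice_def)
    show ?thesis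
    proof
      assume "pref G v (restr G v x) (restr G v y)"
      then have "m = restr G v x" using pref ch by simp
      then have "max (x e) (y e) = x e" if "e \<in> inc G v" for e
        using m_in[OF that] that by (simp add: restr_def)
      then have "y e \<le> x e" if "e \<in> inc G v" for e
        using that by (metis max.cobounded2)
      then show "dom v x y" by (simp add: dom_def tail_iff[OF v nnx])
    next
      assume d: "dom v x y"
      have "m e = x e" if e: "e \<in> inc G v" for e
      proof (cases "filled G x v")
        case True
        \<comment> \<open>\<open>x\<close> already uses the whole quota and lies below the join,
          which still fits.\<close>
        have "sum x (inc G v) = sum m (inc G v)"
          using \<open>sum m (inc G v) \<le> quota G v\<close> True sum_mono[of "inc G v" x m] m_in
          by (simp add: filled_def)
        then have "x e = m e"
          using e m_in by (intro sum_mono_inv[of x "inc G v" m]) auto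
        then show ?thesis by simp
      next
        case False
        then have "y e \<le> x e" using d e by (simp add: dom_def tail_iff[OF v nnx])
        then show ?thesis using m_in e by simp
      qed
      then have "m = restr G v x" using m_out by (auto simp: restr_def)
      then show "pref G v (restr G v x) (restr G v y)" using pref ch by simp
    qed
  next
    case False
    let ?c = "cri m v"
    obtain r where r: "sum m {e \<in> inc G v. rk v e < ?c}
        + (\<Sum>e | e \<in> inc G v \<and> rk v e = ?c. min r (m e)) = quota G v"
      and ch: "choice G v m = (\<lambda>e. if e \<in> inc G v then
       (if rk v e < ?c then m e else if rk v e = ?c then min r (m e) else 0) else 0)"
      by (rule choice_overfull[OF v nnm]) (use False in auto)
    show ?thesis
    proof
      assume "pref G v (restr G v x) (restr G v y)"
      then have eq: "choice G v m = restr G v x" using pref by simp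
      have xe: "x e = (if rk v e < ?c then m e else if rk v e = ?c then min r (m e) else 0)"
        if "e \<in> inc G v" for e
        using fun_cong[OF eq, of e] that unfolding ch restr_def by simp
      have s1: "sum x {e \<in> inc G v. rk v e < ?c} = sum m {e \<in> inc G v. rk v e < ?c}"
        using xe by (intro sum.cong) auto
      have s2: "sum x {e \<in> inc G v. rk v e = ?c} = (\<Sum>e | e \<in> inc G v \<and> rk v e = ?c. min r (m e))"
        using xe by (intro sum.cong) auto
      have s3: "sum x {e \<in> inc G v. rk v e \<le> ?c} = sum x {e \<in> inc G v. rk v e < ?c} + sum x {e \<in> inc G v. rk v e = ?c}"
        by (subst sum.union_disjoint[symmetric]) (auto intro!: sum.cong)
      have s4: "sum x {e \<in> inc G v. rk v e \<le> ?c} = sum x (inc G v)"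
        using xe by (intro sum.mono_neutral_left) auto
      have fl: "filled G x v" using s1 s2 s3 s4 r by (simp add: filled_def)
      have lt: "sum m {e \<in> inc G v. rk v e < ?c} < quota G v"
        using crit_index_props(2)[OF v nnm] False by simp
      have "cri x v = ?c"
        using s1 s2 s3 r lt by (intro crit_index_eqI(2)[OF v nnx]) auto
      have "y e \<le> x e" if et: "e \<in> tail G x v" for e
      proof -
        have e: "e \<in> inc G v" using et tail_iff[OF v nnx] by blast
        consider "rk v e < ?c" | e' where "rk v e = ?c" "e' \<in> inc G v" "rk v e' = ?c" "x e < x e'"
          using et fl \<open>cri x v = ?c\<close> tail_iff[OF v nnx, where e = e] by auto
        then have "x e = m e"
        proof cases
          case 1
          then show ?thesis using xe[OF e] by simp
        next
          case 2
          then show ?thesis using xe[OF e] xe[of e'] by (auto simp: min_def split: if_splits)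
        qed
        then show ?thesis using m_in[OF e] by simp
      qed
      then show "dom v x y" by (simp add: dom_def)
    next
      assume d: "dom v x y"
      have fl: "filled G x v"
      proof (rule ccontr)
        assume "\<not> filled G x v"
        then have "m e = x e" if "e \<in> inc G v" for e
          using d that m_in by (simp add: dom_def tail_iff[OF v nnx] max_absorb1)
        then show False using False assignment_sum_le[OF x v] by simp
      qed
      let ?d = "cri x v"
      have better: "m e = x e" if "e \<in> inc G v" "rk v e < ?d" for e
        using d that m_in by (simp add: dom_def tail_iff[OF v nnx] max_absorb1)
      have q: "quota G v \<le> sum x (inc G v)" using fl by (simp add: filled_def)
      note cx = crit_index_props[OF v nnx q]
      have s1: "sum m {e \<in> inc G v. rk v e < ?d} = sum x {e \<in> inc G v. rk v e < ?d}"
        using better by (intro sum.cong) auto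
      have "sum x {e \<in> inc G v. rk v e \<le> ?d} \<le> sum m {e \<in> inc G v. rk v e \<le> ?d}"
        using m_in by (intro sum_mono) auto
      then have c: "?c = ?d"
        using s1 cx by (intro crit_index_eqI(2)[OF v nnm]) auto
      let ?T = "{e \<in> inc G v. rk v e = ?d}"
      have s3: "sum x {e \<in> inc G v. rk v e \<le> ?d} = sum x {e \<in> inc G v. rk v e < ?d} + sum x ?T"
        by (subst sum.union_disjoint[symmetric]) (auto intro!: sum.cong)
      have s4: "sum x {e \<in> inc G v. rk v e \<le> ?d} = sum x (inc G v)"
      proof (rule sum.mono_neutral_left, goal_cases)
        case 3
        show ?case using zero_beyond_crit[OF v nnx fl] by fastforce
      qed auto
      have "?T \<noteq> {}" using s3 cx by force
      \<comment> \<open>The head level of \<open>x\<close>. Cutting the join there gives back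
        \<open>x\<close>: below that level the edge is in the tail and \<open>m e = x e\<close>; at
        that level \<open>m e\<close> can only be larger.\<close>
      define s where "s = Max (x ` ?T)"
      have ms: "min s (m e) = x e" if e: "e \<in> ?T" for e
      proof -
        have le: "x e' \<le> s" if "e' \<in> ?T" for e' using that by (simp add: s_def)
        have "s \<in> x ` ?T" unfolding s_def using \<open>?T \<noteq> {}\<close> by (intro Max_in) auto
        then obtain e' where e': "e' \<in> ?T" "x e' = s" by auto
        have "m e = x e" if "x e < s"
        proof -
          have "e \<in> tail G x v" using e e' that unfolding tail_iff[OF v nnx] by auto
          then show ?thesis using d e m_in unfolding dom_def by (simp add: max.absorb1)
        qed
        then show ?thesis using le[OF e] m_in[of e] e by fastforce
      qed
      have "(\<Sum>e\<in>?T. min s (m e)) = sum x ?T" using ms by (intro sum.cong) auto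
      then have eqs: "(\<Sum>e\<in>?T. min r (m e)) = (\<Sum>e\<in>?T. min s (m e))"
        using r s1 s3 s4 fl unfolding c filled_def by simp
      have "min r (m e) = x e" if "e \<in> ?T" for e
        using cut_height_unique[OF _ eqs that] ms[OF that] by simp
      then have "choice G v m = restr G v x"
        unfolding ch c restr_def using better zero_beyond_crit[OF v nnx fl]
        by (auto simp: fun_eq_iff)
      then show "pref G v (restr G v x) (restr G v y)" using pref by simp
    qed
  qed
qed


subsection \<open>Comparing two assignments at a vertex\<close>

lemma tailI_better:
  assumes "v \<in> Fs G \<union> Ws G" "assignment G x" "e \<in> inc G v" "rk v e < cri x v"
  shows "e \<in> tail G x v"
  using assms assignment_nonneg[OF assms(2)] by (simp add: tail_iff)

lemma tailI_unfilled:
  assumes "v \<in> Fs G \<union> Ws G" "assignment G x" "e \<in> inc G v" "\<not> filled G x v"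
  shows "e \<in> tail G x v"
  using assms by (simp add: tail_def)

lemma tailI_crit:
  assumes "v \<in> Fs G \<union> Ws G" "assignment G x" "e \<in> inc G v" "rk v e = cri x v"
    "e' \<in> inc G v" "rk v e' = cri x v" "x e < x e'"
  shows "e \<in> tail G x v"
  using assms assignment_nonneg[OF assms(2)] by (auto simp: tail_iff)

lemma tail_inc: "e \<in> tail G x v \<Longrightarrow> e \<in> inc G v"
  by (auto simp: tail_def split: if_splits)

lemma crit_sums:
  assumes "v \<in> Fs G \<union> Ws G" "assignment G x" "filled G x v"
  shows "sum x {e \<in> inc G v. rk v e < cri x v} < quota G v"
    "sum x {e \<in> inc G v. rk v e \<le> cri x v} = quota G v"
proof -
  have nn: "\<forall>e\<in>inc G v. 0 \<le> x e" using assignment_nonneg[OF assms(2)] by simp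
  show "sum x {e \<in> inc G v. rk v e < cri x v} < quota G v"
    using crit_index_props(2)[OF assms(1) nn] assms(3) by (simp add: filled_def)
  have "sum x {e \<in> inc G v. rk v e \<le> cri x v} = sum x (inc G v)"
  proof (rule sum.mono_neutral_left, goal_cases)
    case 3
    show ?case using zero_beyond_crit[OF assms(1) nn assms(3)] by fastforce
  qed auto
  then show "sum x {e \<in> inc G v. rk v e \<le> cri x v} = quota G v"
    using assms(3) by (simp add: filled_def)
qed

lemma zero_beyond:
  assumes "v \<in> Fs G \<union> Ws G" "assignment G x" "filled G x v" "e \<in> inc G v" "cri x v < rk v e"
  shows "x e = 0"
  using zero_beyond_crit[OF assms(1) _ assms(3-5)] assignment_nonneg[OF assms(2)] by simp

lemma pos_le_crit:
  assumes "v \<in> Fs G \<union> Ws G" "assignment G x" "filled G x v" "e \<in> inc G v" "0 < x e"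
  shows "rk v e \<le> cri x v"
  using zero_beyond[OF assms(1-4)] assms(5) by force

text \<open>Positivity holds since the better ties alone stay strictly below the quota, so the
  critical tie must contribute. It is what leaves room for decreasing the head.\<close>

lemma headD:
  assumes "v \<in> Fs G \<union> Ws G" "assignment G x" "e \<in> head G x v"
  shows "filled G x v" "e \<in> inc G v" "rk v e = cri x v"
    "\<And>e'. e' \<in> inc G v \<Longrightarrow> rk v e' = cri x v \<Longrightarrow> x e' \<le> x e" "0 < x e" "e \<notin> tail G x v"
proof -
  have nn: "\<forall>e\<in>inc G v. 0 \<le> x e" using assignment_nonneg[OF assms(2)] by simp
  show 1: "filled G x v" "e \<in> inc G v" "rk v e = cri x v" and
    le: "\<And>e'. e' \<in> inc G v \<Longrightarrow> rk v e' = cri x v \<Longrightarrow> x e' \<le> x e"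
    using assms(3) head_iff[OF assms(1) nn] by auto
  show "e \<notin> tail G x v"
    using assms(3) 1 by (simp add: tail_def)
  show "0 < x e"
  proof (rule ccontr)
    assume "\<not> 0 < x e"
    then have "x e' = 0" if "e' \<in> inc G v" "rk v e' = cri x v" for e'
      using le[OF that] nn that by force
    then have "\<forall>e\<in>{e \<in> inc G v. rk v e \<le> cri x v} - {e \<in> inc G v. rk v e < cri x v}. x e = 0"
      using le_neq_implies_less by blast
    then have "sum x {e \<in> inc G v. rk v e < cri x v} = sum x {e \<in> inc G v. rk v e \<le> cri x v}"
      by (intro sum.mono_neutral_left) auto
    then show False using crit_sums[OF assms(1,2) 1(1)] by simp
  qed
qed

lemma headI:
  assumes v: "v \<in> Fs G \<union> Ws G" "assignment G x" and e: "e \<in> inc G v" "e \<notin> tail G x v" "rk v e \<le> cri x v"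
  shows "e \<in> head G x v"
proof -
  have fl: "filled G x v" using tailI_unfilled[OF v] e by blast
  moreover have "rk v e = cri x v" using tailI_better[OF v] e le_neq_implies_less by blast
  ultimately show ?thesis
    using e tailI_crit[OF v e(1)] assignment_nonneg[OF v(2)]
    by (subst head_iff[OF v(1)]) (auto simp: not_less[symmetric])
qed

lemma head_exists:
  assumes v: "v \<in> Fs G \<union> Ws G" "assignment G x" and fl: "filled G x v"
  shows "head G x v \<noteq> {}"
proof -
  let ?T = "{e \<in> inc G v. rk v e = cri x v}"
  have "?T \<noteq> {}"
  proof
    assume "?T = {}"
    then have "{e \<in> inc G v. rk v e < cri x v} = {e \<in> inc G v. rk v e \<le> cri x v}"
      by (auto simp: order_le_less)
    then show False using crit_sums[OF v fl] by simp
  qed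
  then have "Max (x ` ?T) \<in> x ` ?T" by (intro Max_in) auto
  then obtain e where e: "e \<in> ?T" "Max (x ` ?T) = x e" by blast
  have "\<forall>e'\<in>?T. x e' \<le> x e" unfolding e(2)[symmetric] by simp
  then have "e \<in> head G x v"
    using fl e(1) assignment_nonneg[OF v(2)] by (subst head_iff[OF v(1)]) auto
  then show ?thesis by blast
qed

lemma not_tail_crit:
  assumes "v \<in> Fs G \<union> Ws G" "assignment G x" "e \<in> inc G v" "e \<notin> tail G x v"
  shows "filled G x v" "cri x v \<le> rk v e"
  using assms tailI_better tailI_unfilled not_less by blast+

lemma dom_sum_le:
  assumes v: "v \<in> Fs G \<union> Ws G" and x: "assignment G x" and y: "assignment G y" and d: "dom v x y"
  shows "sum y (inc G v) \<le> sum x (inc G v)"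
proof (cases "filled G x v")
  case True
  then show ?thesis using assignment_sum_le[OF y v] by (simp add: filled_def)
next
  case False
  then show ?thesis
    using d tailI_unfilled[OF v x] by (intro sum_mono) (auto simp: dom_def)
qed

text \<open>On the ties better than its critical one \<open>x\<close> bounds \<open>y\<close> from
  above, so \<open>y\<close> cannot reach the quota there.\<close>

lemma dom_crit_le:
  assumes v: "v \<in> Fs G \<union> Ws G" and x: "assignment G x" and y: "assignment G y" and d: "dom v x y"
    and fl: "filled G x v" "filled G y v"
  shows "cri x v \<le> cri y v"
proof (rule ccontr)
  assume "\<not> cri x v \<le> cri y v"
  then have lt: "cri y v < cri x v" by simp
  have "sum y {e \<in> inc G v. rk v e \<le> cri y v} \<le> sum x {e \<in> inc G v. rk v e \<le> cri y v}"
    using lt d tailI_better[OF v x] by (intro sum_mono) (auto simp: dom_def)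
  also have "\<dots> \<le> sum x {e \<in> inc G v. rk v e < cri x v}"
    using lt assignment_nonneg[OF x] by (intro sum_mono2) auto
  finally show False using crit_sums[OF v x fl(1)] crit_sums[OF v y fl(2)] by simp
qed

text \<open>Outside the tail of the worse assignment the better one can only have decreased; this is what
  turns a preference of one class into the opposite preference of the other class.\<close>

lemma dom_not_tail_le:
  assumes v: "v \<in> Fs G \<union> Ws G" and x: "assignment G x" and y: "assignment G y" and d: "dom v x y"
    and e: "e \<in> inc G v" "e \<notin> tail G y v"
  shows "x e \<le> y e"
proof (rule ccontr)
  assume "\<not> x e \<le> y e"
  then have gt: "y e < x e" by simp
  have fly: "filled G y v" "cri y v \<le> rk v e" using not_tail_crit[OF v y e] by auto
  have flx: "filled G x v"
    using dom_sum_le[OF v x y d] fly(1) assignment_sum_le[OF x v] by (simp add: filled_def)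
  have c: "cri x v \<le> cri y v" by (rule dom_crit_le[OF v x y d flx fly(1)])
  have "rk v e \<le> cri x v"
    using pos_le_crit[OF v x flx e(1)] gt assignment_nonneg[OF y, of e] by simp
  then have eq: "cri x v = cri y v" "rk v e = cri y v" using c fly(2) by auto
  then have "e \<in> head G y v" using headI[OF v y e] by simp
  note hd = headD(4)[OF v y this]
  \<comment> \<open>On a head edge of \<open>x\<close> the value is at least \<open>x e\<close>,
    which exceeds \<open>y e\<close>, the maximum of \<open>y\<close> on this tie. So
    \<open>y\<close> is below \<open>x\<close> on all ties that count, strictly at \<open>e\<close>,
    although both sums equal the quota.\<close>
  have "y e' \<le> x e'" if "e' \<in> inc G v" "rk v e' \<le> cri y v" for e'
  proof (cases "e' \<in> tail G x v")
    case True
    then show ?thesis using d by (simp add: dom_def)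
  next
    case False
    then have "e' \<in> head G x v" using headI[OF v x that(1)] that(2) eq by simp
    then have "x e \<le> x e'" "rk v e' = cri y v" using headD[OF v x] eq e(1) by auto
    then show ?thesis using hd[OF that(1)] gt by simp
  qed
  then have "sum y {e' \<in> inc G v. rk v e' \<le> cri y v} < sum x {e' \<in> inc G v. rk v e' \<le> cri y v}"
    using gt e eq by (intro sum_strict_mono_ex1 bexI[of _ e]) auto
  then show False using crit_sums(2)[OF v x flx] crit_sums(2)[OF v y fly(1)] eq by simp
qed

text \<open>Either the critical tie gets worse, and then \<open>x\<close> vanishes on the new one
  while the head of \<open>y\<close> is positive; or it stays, and then \<open>e0\<close> is a head
  edge of \<open>x\<close>, so that \<open>x e \<le> x e0 < y e0 \<le> y e\<close>. One increase
  thus forces an increase on the whole head of \<open>y\<close>.\<close>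

lemma dom_head_less:
  assumes v: "v \<in> Fs G \<union> Ws G" and x: "assignment G x" and y: "assignment G y" and d: "dom v x y"
    and fl: "filled G x v" "filled G y v" and e0: "e0 \<in> inc G v" "x e0 < y e0"
    and e: "e \<in> head G y v"
  shows "x e < y e"
proof -
  have e0': "e0 \<notin> tail G x v" using d e0 by (auto simp: dom_def)
  have c: "cri x v \<le> rk v e0" using not_tail_crit[OF v x e0(1) e0'] by simp
  have c': "rk v e0 \<le> cri y v"
    using pos_le_crit[OF v y fl(2) e0(1)] e0(2) assignment_nonneg[OF x, of e0] by simp
  note h = headD[OF v y e]
  show ?thesis
  proof (cases "cri x v < cri y v")
    case True
    then show ?thesis using zero_beyond[OF v x fl(1) h(2)] h by simp
  next
    case False
    then have eq: "cri x v = cri y v" "rk v e0 = cri x v" using c c' by auto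
    then have "e0 \<in> head G x v" using headI[OF v x e0(1) e0'] by simp
    then have "x e \<le> x e0" using headD(4)[OF v x] h eq by simp
    also have "\<dots> < y e0" by (rule e0)
    also have "\<dots> \<le> y e" using h e0 eq by simp
    finally show ?thesis .
  qed
qed


subsection \<open>Comparing two stable assignments\<close>

lemma stable_assignment: "x \<in> stable_set G \<Longrightarrow> assignment G x"
  by (simp add: stable_set_def)

lemma stable_not_tail:
  "x \<in> stable_set G \<Longrightarrow> e \<in> edges G \<Longrightarrow> x e < cap G e \<Longrightarrow> e \<in> tail G x (fst e)
    \<Longrightarrow> e \<notin> tail G x (snd e)"
  unfolding stable_set_def blocking_def by blast

lemma prefF_iff:
  "prefF G x y \<longleftrightarrow> x \<in> stable_set G \<and> y \<in> stable_set G \<and> (\<forall>f\<in>Fs G. dom f x y)"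
  using pref_restr_iff stable_assignment unfolding prefF_def by (metis UnI1)

text \<open>Stability of \<open>y\<close> enters here: an unsaturated edge in the tail of
  \<open>y\<close> at \<open>w\<close> is outside its tail at \<open>f\<close>, where
  \<open>dom_not_tail_le\<close> applies.\<close>

lemma prefF_dom_W:
  assumes p: "prefF G x y" and w: "w \<in> Ws G"
  shows "dom w y x"
  unfolding dom_def
proof (intro ballI, rule ccontr)
  fix e assume e: "e \<in> tail G y w" and "\<not> x e \<le> y e"
  then have gt: "y e < x e" by simp
  have x: "x \<in> stable_set G" and y: "y \<in> stable_set G" using p by (auto simp: prefF_iff)
  have ei: "e \<in> inc G w" using e by (rule tail_inc)
  then have ed: "e \<in> edges G" "snd e = w" using inc_edge inc_W[OF w] by auto
  have f: "fst e \<in> Fs G" using edge_vertices[OF ed(1)] by simp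
  have "y e < cap G e" using gt assignment_le_cap[OF stable_assignment[OF x] ed(1)] by simp
  then have "e \<notin> tail G y (fst e)" using stable_not_tail[OF y ed(1)] e ed(2) by auto
  then have "x e \<le> y e"
    using dom_not_tail_le[of "fst e" x y e] p f stable_assignment[OF x] stable_assignment[OF y]
      edge_inc[OF ed(1)] by (auto simp: prefF_iff)
  then show False using gt by simp
qed

lemma inc_disjoint_F: "f \<in> Fs G \<Longrightarrow> f' \<in> Fs G \<Longrightarrow> f \<noteq> f' \<Longrightarrow> inc G f \<inter> inc G f' = {}"
  using inc_F by blast

lemma inc_disjoint_W: "w \<in> Ws G \<Longrightarrow> w' \<in> Ws G \<Longrightarrow> w \<noteq> w' \<Longrightarrow> inc G w \<inter> inc G w' = {}"
  using inc_W by blast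

lemma sum_edges_F: "sum g (edges G) = (\<Sum>f\<in>Fs G. sum g (inc G f))"
proof -
  have "edges G = (\<Union>f\<in>Fs G. inc G f)"
    using edge_vertices edge_inc inc_edge by fast
  then show ?thesis
    using finite_Fs inc_disjoint_F by (simp add: sum.UNION_disjoint)
qed

lemma sum_edges_W: "sum g (edges G) = (\<Sum>w\<in>Ws G. sum g (inc G w))"
proof -
  have "edges G = (\<Union>w\<in>Ws G. inc G w)"
    using edge_vertices edge_inc inc_edge by fast
  then show ?thesis
    using finite_Ws inc_disjoint_W by (simp add: sum.UNION_disjoint)
qed

text \<open>Double counting: passing from \<open>x\<close> to \<open>y\<close>, vertex sums can only
  drop in one class and only grow in the other, yet each class adds up to the same total over all
  edges.\<close>

lemma prefF_sum_eq:
  assumes p: "prefF G x y" and v: "v \<in> Fs G \<union> Ws G"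
  shows "sum x (inc G v) = sum y (inc G v)"
proof -
  have x: "assignment G x" and y: "assignment G y"
    using p stable_assignment by (auto simp: prefF_iff)
  have F: "sum y (inc G f) \<le> sum x (inc G f)" if "f \<in> Fs G" for f
    using dom_sum_le[OF _ x y] p that by (auto simp: prefF_iff)
  have W: "sum x (inc G w) \<le> sum y (inc G w)" if "w \<in> Ws G" for w
    using dom_sum_le[OF _ y x] prefF_dom_W[OF p that] that by auto
  have "sum y (edges G) \<le> sum x (edges G)"
    unfolding sum_edges_F using F by (rule sum_mono)
  moreover have "sum x (edges G) \<le> sum y (edges G)"
    unfolding sum_edges_W using W by (rule sum_mono)
  ultimately have eq: "sum x (edges G) = sum y (edges G)" by simp
  show ?thesis
    using v
  proof
    assume "v \<in> Fs G"
    then show ?thesis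
      using sum_mono_inv[of "\<lambda>f. sum y (inc G f)" "Fs G" "\<lambda>f. sum x (inc G f)"] eq F finite_Fs
      unfolding sum_edges_F by simp
  next
    assume "v \<in> Ws G"
    then show ?thesis
      using sum_mono_inv[of "\<lambda>f. sum x (inc G f)" "Ws G" "\<lambda>f. sum y (inc G f)"] eq W finite_Ws
      unfolding sum_edges_W by simp
  qed
qed

lemma sums_differ:
  fixes x y :: "'a \<Rightarrow> real"
  assumes "finite A" "sum x A = sum y A" "e \<in> A" "x e \<noteq> y e"
  obtains e' where "e' \<in> A" "x e' < y e'"
  using sum_mono_inv[of y A x e] assms by (metis not_le)

lemma prefF_filled: "prefF G x y \<Longrightarrow> v \<in> Fs G \<union> Ws G \<Longrightarrow> filled G x v \<longleftrightarrow> filled G y v"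
  using prefF_sum_eq by (simp add: filled_def)

text \<open>At an unfilled vertex every edge is in the tail, so dominance is a coordinatewise
  inequality, and the sums agree.\<close>

lemma prefF_unfilled_eq:
  assumes p: "prefF G x y" and v: "v \<in> Fs G \<union> Ws G" and n: "\<not> filled G x v" and e: "e \<in> inc G v"
  shows "x e = y e"
proof (rule ccontr)
  assume ne: "x e \<noteq> y e"
  have x: "assignment G x" and y: "assignment G y"
    using p stable_assignment by (auto simp: prefF_iff)
  have n': "\<not> filled G y v" using prefF_filled[OF p v] n by simp
  show False
    using v
  proof
    assume "v \<in> Fs G"
    then have "y e' \<le> x e'" if "e' \<in> inc G v" for e'
      using p tailI_unfilled[OF v x that n] by (auto simp: prefF_iff dom_def)
    then show False
      using sums_differ[OF finite_inc prefF_sum_eq[OF p v] e ne] by (metis not_le)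
  next
    assume "v \<in> Ws G"
    then have "x e' \<le> y e'" if "e' \<in> inc G v" for e'
      using prefF_dom_W[OF p] tailI_unfilled[OF v y that n'] by (auto simp: dom_def)
    then show False
      using sums_differ[OF finite_inc prefF_sum_eq[OF p v, symmetric] e] ne by (metis not_le)
  qed
qed


subsection \<open>The active structure\<close>

lemma cand_iff:
  assumes f: "f \<in> Fs G"
  shows "i \<in> cand_ties G x f \<longleftrightarrow>
    (\<exists>e\<in>inc G f. rk f e = i \<and> x e < cap G e \<and> e \<in> tail G x (snd e)) \<and>
    (\<forall>e\<in>inc G f. rk f e \<le> i \<longrightarrow> x e < cap G e \<longrightarrow> \<not> deficit G x (snd e))"
proof (cases "i < length (ties G f)")
  case True
  then have "ties G f ! j = {e \<in> inc G f. rk f e = j}" if "j \<le> i" for j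
    using tie_eq[of f j] f that by simp
  then have eqs: "(\<exists>j\<le>i. \<exists>e\<in>ties G f ! j. P e) \<longleftrightarrow> (\<exists>e\<in>inc G f. rk f e \<le> i \<and> P e)"
    "{e \<in> ties G f ! i. P e} \<noteq> {} \<longleftrightarrow> (\<exists>e\<in>inc G f. rk f e = i \<and> P e)" for P
    by auto
  show ?thesis
    unfolding cand_ties_def Dtie_def mem_Collect_eq eqs using True by blast
next
  case False
  then show ?thesis
    using rk_less[of f] f by (auto simp: cand_ties_def)
qed

lemma D_cand:
  assumes f: "f \<in> Fs G" and i: "i \<in> cand_ties G x f"
  obtains l where "l \<in> cand_ties G x f" "\<And>j. j \<in> cand_ties G x f \<Longrightarrow> l \<le> j"
    "D G x f = {e \<in> inc G f. rk f e = l \<and> x e < cap G e \<and> e \<in> tail G x (snd e)}"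
proof -
  define l where "l = (LEAST i. i \<in> cand_ties G x f)"
  have l: "l \<in> cand_ties G x f" unfolding l_def using i by (rule LeastI)
  moreover have le: "l \<le> j" if "j \<in> cand_ties G x f" for j
    unfolding l_def using that by (rule Least_le)
  moreover have "l < length (ties G f)" using l by (simp add: cand_ties_def)
  then have "Dtie G x f l = {e \<in> inc G f. rk f e = l \<and> x e < cap G e \<and> e \<in> tail G x (snd e)}"
    using tie_eq[of f l] f by (auto simp: Dtie_def)
  moreover have "D G x f = Dtie G x f l" using i by (auto simp: D_def l_def)
  ultimately show ?thesis using that[of l] by auto
qed

text \<open>The last item carries the minimality of the tie: freedom from edges to deficit vertices
  passes to better ties, so an unsaturated edge of no worse rank in the tail at its other end would
  make its own tie a candidate, which therefore is the tie of \<open>D\<close> itself.\<close>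

lemma D_props:
  assumes f: "f \<in> Fs G" and e: "e \<in> D G x f"
  shows "e \<in> inc G f" "x e < cap G e" "e \<in> tail G x (snd e)"
    "e' \<in> D G x f \<Longrightarrow> rk f e' = rk f e"
    "j \<in> cand_ties G x f \<Longrightarrow> rk f e \<le> j"
    "e' \<in> inc G f \<Longrightarrow> rk f e' \<le> rk f e \<Longrightarrow> x e' < cap G e' \<Longrightarrow> \<not> deficit G x (snd e')"
    "e' \<in> inc G f \<Longrightarrow> rk f e' \<le> rk f e \<Longrightarrow> x e' < cap G e' \<Longrightarrow> e' \<in> tail G x (snd e') \<Longrightarrow> e' \<in> D G x f"
proof -
  have "cand_ties G x f \<noteq> {}" using e by (auto simp: D_def)
  then obtain i where i: "i \<in> cand_ties G x f" by blast
  obtain l where l: "l \<in> cand_ties G x f" "\<forall>j\<in>cand_ties G x f. l \<le> j"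
    and D: "D G x f = {e \<in> inc G f. rk f e = l \<and> x e < cap G e \<and> e \<in> tail G x (snd e)}"
    by (rule D_cand[OF f i]) blast
  show 1: "e \<in> inc G f" "x e < cap G e" "e \<in> tail G x (snd e)"
    "e' \<in> D G x f \<Longrightarrow> rk f e' = rk f e"
    "j \<in> cand_ties G x f \<Longrightarrow> rk f e \<le> j"
    using e l unfolding D by auto
  have rk: "rk f e = l" using e D by simp
  have "\<forall>e\<in>inc G f. rk f e \<le> l \<longrightarrow> x e < cap G e \<longrightarrow> \<not> deficit G x (snd e)"
    using l(1) cand_iff[OF f, of l x] by simp
  then show nd: "\<not> deficit G x (snd e')"
    if "e' \<in> inc G f" "rk f e' \<le> rk f e" "x e' < cap G e'" for e'
    using that rk by simp
  assume a: "e' \<in> inc G f" "rk f e' \<le> rk f e" "x e' < cap G e'" "e' \<in> tail G x (snd e')"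
  have "rk f e' \<in> cand_ties G x f"
    unfolding cand_iff[OF f] using a nd by force
  then show "e' \<in> D G x f" using l(2) a rk unfolding D by force
qed

lemma D_nonempty: "f \<in> Fs G \<Longrightarrow> i \<in> cand_ties G x f \<Longrightarrow> D G x f \<noteq> {}"
  by (rule D_cand, assumption+) (use cand_iff in blast)

section \<open>Sums over edges and perturbations that are small in the 1-norm\<close>

lemma norm1_bound:
  assumes "e \<in> edges G"
  shows "\<bar>a e\<bar> \<le> norm1 G a"
  unfolding norm1_def using assms finite_edges by (intro member_le_sum) auto

lemma norm1_sum_le:
  assumes "S \<subseteq> edges G"
  shows "sum y S \<le> sum x S + norm1 G (\<lambda>e. y e - x e)"
proof -
  have "sum y S - sum x S = (\<Sum>e\<in>S. y e - x e)" by (simp add: sum_subtractf)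
  also have "\<dots> \<le> (\<Sum>e\<in>S. \<bar>y e - x e\<bar>)" by (intro sum_mono) auto
  also have "\<dots> \<le> norm1 G (\<lambda>e. y e - x e)"
    unfolding norm1_def using assms finite_edges by (intro sum_mono2) auto
  finally show ?thesis by simp
qed

lemma sum_inc_F:
  assumes "f \<in> Fs G"
  shows "sum g (inc G f) = (\<Sum>w | (f, w) \<in> edges G. g (f, w))"
proof -
  have "inc G f = Pair f ` {w. (f, w) \<in> edges G}"
  proof (intro equalityI subsetI)
    fix e assume "e \<in> inc G f"
    then have "e \<in> edges G" "e = Pair f (snd e)"
      using inc_F[OF assms, of e] inc_edge by (simp_all add: prod_eq_iff)
    then show "e \<in> Pair f ` {w. (f, w) \<in> edges G}"
      by (intro image_eqI[of _ _ "snd e"]) auto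
  qed (auto simp: inc_def)
  then show ?thesis by (simp add: sum.reindex inj_on_def)
qed

lemma sum_inc_W:
  assumes "w \<in> Ws G"
  shows "sum g (inc G w) = (\<Sum>f | (f, w) \<in> edges G. g (f, w))"
proof -
  have "inc G w = (\<lambda>f. (f, w)) ` {f. (f, w) \<in> edges G}"
  proof (intro equalityI subsetI)
    fix e assume "e \<in> inc G w"
    then have "e \<in> edges G" "e = (\<lambda>f. (f, w)) (fst e)"
      using inc_W[OF assms, of e] inc_edge by (simp_all add: prod_eq_iff)
    then show "e \<in> (\<lambda>f. (f, w)) ` {f. (f, w) \<in> edges G}"
      by (intro image_eqI[of _ _ "fst e"]) auto
  qed (auto simp: inc_def)
  then show ?thesis by (simp add: sum.reindex inj_on_def)
qed

text \<open>The gaps of \<open>x\<close>: slack below capacities, positive values, the part of the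
  quota left for the critical tie, and differences of values. The last gap is halved because both
  edges may move by \<open>\<epsilon>\<close>.\<close>

definition small :: "'v evec \<Rightarrow> real \<Rightarrow> bool" where
  "small x \<epsilon> \<longleftrightarrow> 0 < \<epsilon> \<and> (\<forall>e\<in>edges G. x e < cap G e \<longrightarrow> \<epsilon> < cap G e - x e) \<and>
    (\<forall>e\<in>edges G. 0 < x e \<longrightarrow> \<epsilon> < x e) \<and>
    (\<forall>v\<in>Fs G \<union> Ws G. filled G x v \<longrightarrow> \<epsilon> < quota G v - sum x {e \<in> inc G v. rk v e < cri x v}) \<and>
    (\<forall>e\<in>edges G. \<forall>e'\<in>edges G. x e < x e' \<longrightarrow> \<epsilon> < (x e' - x e) / 2)"

lemma eventually_small:
  assumes x: "assignment G x"
  shows "\<forall>\<^sub>F \<epsilon> in at_right (0::real). small x \<epsilon>"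
proof -
  have ev: "\<forall>\<^sub>F \<epsilon> in at_right (0::real). P \<longrightarrow> \<epsilon> < a" if "P \<Longrightarrow> 0 < a" for P a
    using that by (cases P) (auto intro: eventually_at_right_real[THEN eventually_mono])
  show ?thesis
    unfolding small_def
    using finite_edges finite_Fs finite_Ws crit_sums(1)[OF _ x]
    by (intro eventually_conj eventually_ball_finite ballI ev eventually_at_right_less) auto
qed

context
  fixes x y :: "'v evec" and \<epsilon> :: real
  assumes sm: "small x \<epsilon>" and near: "norm1 G (\<lambda>e. y e - x e) \<le> \<epsilon>"
begin

lemma near_diff: "e \<in> edges G \<Longrightarrow> \<bar>y e - x e\<bar> \<le> \<epsilon>"
  using norm1_bound[of e "\<lambda>e. y e - x e"] near by simp

lemma near_cap: "e \<in> edges G \<Longrightarrow> x e < cap G e \<Longrightarrow> y e < cap G e"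
  using near_diff[of e] sm by (auto simp: small_def abs_le_iff dest!: bspec[where x = e])

lemma near_pos: "e \<in> edges G \<Longrightarrow> 0 < x e \<Longrightarrow> 0 < y e"
  using near_diff[of e] sm by (auto simp: small_def abs_le_iff dest!: bspec[where x = e])

lemma near_order:
  assumes "e \<in> edges G" "e' \<in> edges G" "x e < x e'"
  shows "y e < y e'"
proof -
  have "\<epsilon> < (x e' - x e) / 2" using sm assms by (simp add: small_def)
  then show ?thesis using near_diff[OF assms(1)] near_diff[OF assms(2)] by (simp add: abs_le_iff)
qed

lemma near_better_sum:
  assumes "v \<in> Fs G \<union> Ws G" "filled G x v"
  shows "sum y {e \<in> inc G v. rk v e < cri x v} < quota G v"
proof -
  have "\<epsilon> < quota G v - sum x {e \<in> inc G v. rk v e < cri x v}"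
    using sm assms by (simp add: small_def)
  moreover have "{e \<in> inc G v. rk v e < cri x v} \<subseteq> edges G" using inc_edge by blast
  then have "sum y {e \<in> inc G v. rk v e < cri x v}
    \<le> sum x {e \<in> inc G v. rk v e < cri x v} + norm1 G (\<lambda>e. y e - x e)"
    by (rule norm1_sum_le)
  ultimately show ?thesis using near by simp
qed

text \<open>The sum over the ties better than the critical one stays below the quota, so the
  critical tie cannot improve. It can get worse, and at vertices in \<open>F\<close> it sometimes
  does.\<close>

lemma near_crit_le:
  assumes v: "v \<in> Fs G \<union> Ws G" and fl: "filled G x v" "filled G y v" and y: "assignment G y"
  shows "cri x v \<le> cri y v"
proof (rule ccontr)
  assume "\<not> cri x v \<le> cri y v"
  then have "sum y {e \<in> inc G v. rk v e \<le> cri y v} \<le> sum y {e \<in> inc G v. rk v e < cri x v}"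
    using assignment_nonneg[OF y] by (intro sum_mono2) auto
  then show False using near_better_sum[OF v fl(1)] crit_sums(2)[OF v y fl(2)] by simp
qed

text \<open>At a filled vertex, tail membership rests on strict inequalities, which survive small
  changes. The converse may fail: equal values in the critical tie may be separated.\<close>

lemma near_tail:
  assumes v: "v \<in> Fs G \<union> Ws G" and x: "assignment G x" and y: "assignment G y"
    and fl: "filled G x v" and c: "cri x v = cri y v" and e: "e \<in> tail G x v"
  shows "e \<in> tail G y v"
proof -
  have ei: "e \<in> inc G v" using e by (rule tail_inc)
  have "e \<in> tail G x v \<longleftrightarrow> e \<in> inc G v \<and> (\<not> filled G x v \<or> rk v e < cri x v
    \<or> (rk v e = cri x v \<and> (\<exists>e'\<in>inc G v. rk v e' = cri x v \<and> x e < x e')))"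
    using assignment_nonneg[OF x] by (intro tail_iff[OF v]) simp
  then consider "rk v e < cri x v"
    | e' where "rk v e = cri x v" "e' \<in> inc G v" "rk v e' = cri x v" "x e < x e'"
    using e fl by auto
  then show ?thesis
  proof cases
    case 1
    then show ?thesis using tailI_better[OF v y ei] c by simp
  next
    case 2
    then show ?thesis
      using tailI_crit[OF v y ei _ 2(2)] near_order[OF inc_edge[OF ei] inc_edge[OF 2(2)]] c by simp
  qed
qed

end

section \<open>The sets D and the heads at a stable assignment\<close>

context
  fixes x :: "'v evec"
  assumes xs: "x \<in> stable_set G"
begin

lemma xa: "assignment G x"
  using xs by (rule stable_assignment)

lemma D_not_tail:
  assumes f: "f \<in> Fs G" and e: "e \<in> D G x f"
  shows "e \<notin> tail G x f"
proof -
  note d = D_props[OF f e]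
  have "fst e = f" using inc_F[OF f d(1)] .
  then show ?thesis using stable_not_tail[OF xs inc_edge[OF d(1)] d(2)] d(3) by auto
qed

lemma D_crit:
  assumes f: "f \<in> Fs G" and e: "e \<in> D G x f"
  shows "filled G x f" "cri x f \<le> rk f e"
  using not_tail_crit[OF _ xa D_props(1)[OF f e] D_not_tail[OF f e]] f by auto

text \<open>Beyond the critical tie \<open>x\<close> vanishes, and within it an edge outside the
  tail is a head edge. Hence a common raise makes \<open>D G x f\<close> the top of its tie.\<close>

lemma D_max:
  assumes f: "f \<in> Fs G" and e: "e \<in> D G x f" and e': "e' \<in> inc G f" "rk f e' = rk f e"
  shows "x e' \<le> x e"
proof (cases "cri x f < rk f e")
  case True
  then have "x e' = 0"
    using zero_beyond[OF _ xa D_crit(1)[OF f e] e'(1)] f e'(2) by simp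
  then show ?thesis using assignment_nonneg[OF xa] by simp
next
  case False
  then have eq: "rk f e = cri x f" using D_crit(2)[OF f e] by simp
  then have "e \<in> head G x f"
    using headI[OF _ xa D_props(1)[OF f e] D_not_tail[OF f e]] f by simp
  then show ?thesis using headD(4)[OF _ xa, of f e e'] f e' eq by simp
qed

lemma D_const:
  assumes f: "f \<in> Fs G" and e: "e \<in> D G x f" and e': "e' \<in> D G x f"
  shows "x e = x e'"
  using D_max[OF f e D_props(1)[OF f e'] D_props(4)[OF f e e']]
    D_max[OF f e' D_props(1)[OF f e] D_props(4)[OF f e' e]] by simp

lemma D_filled_W:
  assumes f: "f \<in> Fs G" and e: "e \<in> D G x f"
  shows "filled G x (snd e)"
proof -
  have "snd e \<in> Fs G \<union> Ws G" using edge_vertices[OF inc_edge[OF D_props(1)[OF f e]]] by simp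
  then show ?thesis
    using D_props(6)[OF f e D_props(1)[OF f e] _ D_props(2)[OF f e]] deficit_iff[OF xa] by auto
qed

lemma D_disjoint_head:
  assumes f: "f \<in> Fs G" and e: "e \<in> D G x f"
  shows "e \<notin> head G x (snd e)"
proof -
  have "snd e \<in> Fs G \<union> Ws G" using edge_vertices[OF inc_edge[OF D_props(1)[OF f e]]] by simp
  then show ?thesis using headD(6)[OF _ xa] D_props(3)[OF f e] by blast
qed

lemma FplusD:
  assumes "f \<in> Fplus G x"
  shows "f \<in> Fs G" "filled G x f" "D G x f \<noteq> {}" "e \<in> D G x f \<Longrightarrow> snd e \<in> Wplus G x"
proof -
  show f: "f \<in> Fs G" "filled G x f" using assms by (auto simp: Fplus_def Feq_def)
  show "D G x f \<noteq> {}" using assms V0.F_empty[of f G x] by (auto simp: Fplus_def)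
  assume e: "e \<in> D G x f"
  have "e \<in> inc G f" using D_props(1)[OF f(1) e] .
  then have ew: "e = (f, snd e)" "snd e \<in> Ws G"
    using inc_F[OF f(1), of e] edge_vertices[OF inc_edge, of e] by (simp_all add: prod_eq_iff)
  then have "snd e \<notin> V0 G x"
    using assms e V0.F_step[of f G x "snd e"] by (auto simp: Fplus_def)
  then show "snd e \<in> Wplus G x"
    using ew D_filled_W[OF f(1) e] by (simp add: Wplus_def Weq_def)
qed

lemma WplusD:
  assumes "w \<in> Wplus G x"
  shows "w \<in> Ws G" "filled G x w" "head G x w \<noteq> {}" "e \<in> head G x w \<Longrightarrow> fst e \<in> Fplus G x"
proof -
  show w: "w \<in> Ws G" "filled G x w" using assms by (auto simp: Wplus_def Weq_def)
  show "head G x w \<noteq> {}" using head_exists[OF _ xa w(2)] w by simp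
  assume e: "e \<in> head G x w"
  have "e \<in> inc G w" using headD(2)[OF _ xa e] w by simp
  then have ew: "e = (fst e, w)" "fst e \<in> Fs G"
    using inc_W[OF w(1), of e] edge_vertices[OF inc_edge, of e] by (simp_all add: prod_eq_iff)
  have "\<not> deficit G x (fst e)"
    using assms e ew V0.W_deficit[of w G x "fst e"] by (auto simp: Wplus_def)
  then have fl: "filled G x (fst e)" using deficit_iff[OF xa] ew by simp
  have "fst e \<notin> V0 G x"
    using assms e ew V0.W_step[of w G x "fst e"] by (auto simp: Wplus_def)
  then show "fst e \<in> Fplus G x"
    using ew fl by (simp add: Fplus_def Feq_def)
qed

section \<open>The step Delta as a raise at F minus a cut at W\<close>

definition up :: "('v \<Rightarrow> real) \<Rightarrow> 'v evec" where
  "up \<phi> e = (if fst e \<in> Fplus G x \<and> e \<in> D G x (fst e) then \<phi> (fst e) else 0)"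

definition down :: "('v \<Rightarrow> real) \<Rightarrow> 'v evec" where
  "down \<psi> e = (if snd e \<in> Wplus G x \<and> e \<in> head G x (snd e) then \<psi> (snd e) else 0)"

lemma up_zero_head: "e \<in> head G x (snd e) \<Longrightarrow> up \<phi> e = 0"
  using D_disjoint_head[of "fst e" e] FplusD(1)[of "fst e"] by (auto simp: up_def)

text \<open>An edge of \<open>D\<close> lies in the tail of \<open>x\<close> at its end in
  \<open>W\<close> and a head edge never does, so the two cases exclude each other.\<close>

lemma Delta_eq: "Delta G x \<phi> \<psi> e = up \<phi> e - down \<psi> e"
proof -
  have "\<not> (fst e \<in> Fplus G x \<and> e \<in> D G x (fst e))" if "e \<in> head G x (snd e)"
    using that D_disjoint_head[of "fst e" e] FplusD(1)[of "fst e"] by blast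
  then show ?thesis
    by (cases e) (auto simp: Delta_def up_def down_def)
qed

lemma D_edges: "f \<in> Fplus G x \<Longrightarrow> D G x f \<subseteq> inc G f"
  using D_props(1) FplusD(1) by blast

lemma head_edges: "w \<in> Wplus G x \<Longrightarrow> head G x w \<subseteq> inc G w"
  using headD(2)[OF _ xa] WplusD(1) by blast

lemma sum_up_F:
  assumes f: "f \<in> Fs G"
  shows "sum (up \<phi>) (inc G f) = (if f \<in> Fplus G x then real (card (D G x f)) * \<phi> f else 0)"
proof -
  have "sum (up \<phi>) (inc G f) = (\<Sum>e\<in>inc G f. if f \<in> Fplus G x \<and> e \<in> D G x f then \<phi> f else 0)"
    using inc_F[OF f] by (intro sum.cong) (auto simp: up_def)
  also have "\<dots> = (if f \<in> Fplus G x then \<Sum>e\<in>D G x f. \<phi> f else 0)"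
    using D_edges[of f] by (auto simp: sum.inter_restrict[symmetric] Int_absorb1)
  finally show ?thesis by simp
qed

lemma sum_down_W:
  assumes w: "w \<in> Ws G"
  shows "sum (down \<psi>) (inc G w) = (if w \<in> Wplus G x then real (card (head G x w)) * \<psi> w else 0)"
proof -
  have "sum (down \<psi>) (inc G w) = (\<Sum>e\<in>inc G w. if w \<in> Wplus G x \<and> e \<in> head G x w then \<psi> w else 0)"
    using inc_W[OF w] by (intro sum.cong) (auto simp: down_def)
  also have "\<dots> = (if w \<in> Wplus G x then \<Sum>e\<in>head G x w. \<psi> w else 0)"
    using head_edges[of w] by (auto simp: sum.inter_restrict[symmetric] Int_absorb1)
  finally show ?thesis by simp
qed

lemma finite_nbrs: "finite {w. (f, w) \<in> edges G}" "finite {f. (f, w) \<in> edges G}" for f w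
  using edges_bipartite finite_subset[OF _ finite_Ws, of "{w. (f, w) \<in> edges G}"]
    finite_subset[OF _ finite_Fs, of "{f. (f, w) \<in> edges G}"] by auto

lemma sum_down_F:
  assumes f: "f \<in> Fs G"
  shows "sum (down \<psi>) (inc G f) = (\<Sum>w | w \<in> Wplus G x \<and> (f, w) \<in> head G x w. \<psi> w)"
proof -
  have "{w \<in> {w. (f, w) \<in> edges G}. w \<in> Wplus G x \<and> (f, w) \<in> head G x w}
    = {w. w \<in> Wplus G x \<and> (f, w) \<in> head G x w}"
    using head_edges inc_edge by blast
  then show ?thesis
    using sum.inter_filter[OF finite_nbrs(1)[of f], of \<psi> "\<lambda>w. w \<in> Wplus G x \<and> (f, w) \<in> head G x w"]
    by (simp add: sum_inc_F[OF f] down_def cong: if_cong)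
qed

lemma sum_up_W:
  assumes w: "w \<in> Ws G"
  shows "sum (up \<phi>) (inc G w) = (\<Sum>f | f \<in> Fplus G x \<and> (f, w) \<in> D G x f. \<phi> f)"
proof -
  have "{f \<in> {f. (f, w) \<in> edges G}. f \<in> Fplus G x \<and> (f, w) \<in> D G x f}
    = {f. f \<in> Fplus G x \<and> (f, w) \<in> D G x f}"
    using D_edges inc_edge by blast
  then show ?thesis
    using sum.inter_filter[OF finite_nbrs(2)[of w], of \<phi> "\<lambda>f. f \<in> Fplus G x \<and> (f, w) \<in> D G x f"]
    by (simp add: sum_inc_W[OF w] up_def cong: if_cong)
qed

text \<open>Raise and cut have disjoint supports, so nothing cancels; the raise is summed over
  \<open>F\<close> and the cut over \<open>W\<close>.\<close>

lemma norm1_Delta: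
  assumes \<phi>: "\<forall>f\<in>Fplus G x. 0 \<le> \<phi> f" and \<psi>: "\<forall>w\<in>Wplus G x. 0 \<le> \<psi> w"
  shows "norm1 G (Delta G x \<phi> \<psi>) = (\<Sum>f\<in>Fplus G x. real (card (D G x f)) * \<phi> f)
    + (\<Sum>w\<in>Wplus G x. real (card (head G x w)) * \<psi> w)"
proof -
  have "\<bar>Delta G x \<phi> \<psi> e\<bar> = up \<phi> e + down \<psi> e" for e
    using up_zero_head[of e \<phi>] \<phi> \<psi> by (auto simp: Delta_eq up_def down_def)
  then have "norm1 G (Delta G x \<phi> \<psi>) = sum (up \<phi>) (edges G) + sum (down \<psi>) (edges G)"
    by (simp add: norm1_def sum.distrib)
  moreover have "sum (up \<phi>) (edges G) = (\<Sum>f\<in>Fs G. if f \<in> Fplus G x then real (card (D G x f)) * \<phi> f else 0)"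
    by (simp add: sum_edges_F sum_up_F)
  moreover have "sum (down \<psi>) (edges G) = (\<Sum>w\<in>Ws G. if w \<in> Wplus G x then real (card (head G x w)) * \<psi> w else 0)"
    by (simp add: sum_edges_W sum_down_W)
  moreover have "Fs G \<inter> Fplus G x = Fplus G x" "Ws G \<inter> Wplus G x = Wplus G x"
    using FplusD(1) WplusD(1) by auto
  ultimately show ?thesis
    using finite_Fs finite_Ws by (simp add: sum.inter_restrict[symmetric])
qed

text \<open>Summing \<open>up\<close> and \<open>down\<close> over the edges at a vertex gives the
  two terms of its balance equation. Both inclusions of (a) use \<open>P_eps\<close> in this form,
  as conservation of vertex sums.\<close>

lemma P_eps_iff:
  "(\<phi>, \<psi>) \<in> P_eps G x \<epsilon> \<longleftrightarrow>
    (\<forall>v. v \<notin> Fplus G x \<longrightarrow> \<phi> v = 0) \<and> (\<forall>v. v \<notin> Wplus G x \<longrightarrow> \<psi> v = 0) \<and>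
    (\<forall>f\<in>Fplus G x. 0 \<le> \<phi> f) \<and> (\<forall>w\<in>Wplus G x. 0 \<le> \<psi> w) \<and>
    (\<forall>f\<in>Fplus G x. sum (Delta G x \<phi> \<psi>) (inc G f) = 0) \<and>
    (\<forall>w\<in>Wplus G x. sum (Delta G x \<phi> \<psi>) (inc G w) = 0) \<and> norm1 G (Delta G x \<phi> \<psi>) = \<epsilon>"
proof -
  have F: "sum (Delta G x \<phi> \<psi>) (inc G f) = real (card (D G x f)) * \<phi> f
      - (\<Sum>w | w \<in> Wplus G x \<and> (f, w) \<in> head G x w. \<psi> w)" if "f \<in> Fplus G x" for f
    using that FplusD(1)[OF that] by (simp add: Delta_eq sum_subtractf sum_up_F sum_down_F)
  have W: "sum (Delta G x \<phi> \<psi>) (inc G w) = (\<Sum>f | f \<in> Fplus G x \<and> (f, w) \<in> D G x f. \<phi> f)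
      - real (card (head G x w)) * \<psi> w" if "w \<in> Wplus G x" for w
    using that WplusD(1)[OF that] by (simp add: Delta_eq sum_subtractf sum_up_W sum_down_W)
  show ?thesis
    unfolding P_eps_def using F W norm1_Delta[of \<phi> \<psi>] by auto
qed


subsection \<open>Active steps lead to stable assignments\<close>

lemma Delta_pos:
  assumes \<psi>: "\<forall>w\<in>Wplus G x. 0 \<le> \<psi> w" and pos: "0 < Delta G x \<phi> \<psi> e"
  shows "fst e \<in> Fplus G x" "e \<in> D G x (fst e)"
  using assms by (auto simp: Delta_eq up_def down_def split: if_splits)

lemma Delta_neg:
  assumes \<phi>: "\<forall>f\<in>Fplus G x. 0 \<le> \<phi> f" and neg: "Delta G x \<phi> \<psi> e < 0"
  shows "snd e \<in> Wplus G x" "e \<in> head G x (snd e)"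
  using assms by (auto simp: Delta_eq up_def down_def split: if_splits)

lemma Delta_outside: "e \<notin> edges G \<Longrightarrow> Delta G x \<phi> \<psi> e = 0"
  using D_edges[of "fst e"] head_edges[of "snd e"] inc_edge[of e]
  by (auto simp: Delta_eq up_def down_def)

text \<open>By the closure rules of \<open>V0\<close>, the active edges of \<open>Fplus\<close> end
  in \<open>Wplus\<close> and conversely, so no active edge touches another vertex.\<close>

lemma Delta_unmoved:
  assumes v: "v \<in> Fs G \<union> Ws G" and n: "v \<notin> Fplus G x" "v \<notin> Wplus G x" and e: "e \<in> inc G v"
  shows "Delta G x \<phi> \<psi> e = 0"
  using v
proof
  assume "v \<in> Fs G"
  then have "fst e \<notin> Fplus G x" using inc_F e n by simp
  then show ?thesis using WplusD(4)[of "snd e" e] by (auto simp: Delta_eq up_def down_def)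
next
  assume "v \<in> Ws G"
  then have "snd e \<notin> Wplus G x" using inc_W e n by simp
  then show ?thesis using FplusD(4)[of "fst e" e] by (auto simp: Delta_eq up_def down_def)
qed

context
  fixes \<phi> \<psi> :: "'v \<Rightarrow> real" and \<epsilon> :: real and y :: "'v evec"
  assumes P: "(\<phi>, \<psi>) \<in> P_eps G x \<epsilon>" and sm: "small x \<epsilon>"
  defines "y \<equiv> \<lambda>e. x e + Delta G x \<phi> \<psi> e"
begin

lemma step_facts:
  "\<forall>f\<in>Fplus G x. 0 \<le> \<phi> f" "\<forall>w\<in>Wplus G x. 0 \<le> \<psi> w" "norm1 G (Delta G x \<phi> \<psi>) = \<epsilon>"
  "v \<in> Fs G \<union> Ws G \<Longrightarrow> sum (Delta G x \<phi> \<psi>) (inc G v) = 0"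
proof -
  show "\<forall>f\<in>Fplus G x. 0 \<le> \<phi> f" "\<forall>w\<in>Wplus G x. 0 \<le> \<psi> w" "norm1 G (Delta G x \<phi> \<psi>) = \<epsilon>"
    using P by (auto simp: P_eps_iff)
  assume v: "v \<in> Fs G \<union> Ws G"
  show "sum (Delta G x \<phi> \<psi>) (inc G v) = 0"
  proof (cases "v \<in> Fplus G x \<or> v \<in> Wplus G x")
    case True
    then show ?thesis using P by (auto simp: P_eps_iff)
  next
    case False
    then show ?thesis using Delta_unmoved[OF v] by (intro sum.neutral) auto
  qed
qed

lemma step_near: "norm1 G (\<lambda>e. y e - x e) = \<epsilon>"
  using step_facts(3) by (simp add: y_def)

lemma step_sum: "v \<in> Fs G \<union> Ws G \<Longrightarrow> sum y (inc G v) = sum x (inc G v)"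
  using step_facts(4) by (simp add: y_def sum.distrib)

lemma step_filled: "v \<in> Fs G \<union> Ws G \<Longrightarrow> filled G y v \<longleftrightarrow> filled G x v"
  using step_sum by (simp add: filled_def)

lemma step_assignment: "assignment G y"
  unfolding assignment_def
proof (intro conjI ballI allI impI)
  fix e assume "e \<notin> edges G"
  then show "y e = 0" using Delta_outside assignment_zero[OF xa] by (simp add: y_def)
next
  fix e assume e: "e \<in> edges G"
  show "0 \<le> y e"
  proof (cases "Delta G x \<phi> \<psi> e < 0")
    case True
    have "snd e \<in> Fs G \<union> Ws G" using edge_vertices[OF e] by simp
    then have "0 < x e" using headD(5)[OF _ xa] Delta_neg(2)[OF step_facts(1) True] by blast
    then show ?thesis using near_pos[OF sm _ e, of y] step_near by simp
  next
    case False
    then show ?thesis using assignment_nonneg[OF xa, of e] by (simp add: y_def)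
  qed
  show "y e \<le> cap G e"
  proof (cases "0 < Delta G x \<phi> \<psi> e")
    case True
    have "x e < cap G e"
      using D_props(2)[OF FplusD(1)] Delta_pos[OF step_facts(2) True] by blast
    then show ?thesis using near_cap[OF sm _ e, of y] step_near by simp
  next
    case False
    then show ?thesis using assignment_le_cap[OF xa e] by (simp add: y_def)
  qed
next
  fix v assume "v \<in> Fs G \<union> Ws G"
  then show "sum y (inc G v) \<le> quota G v"
    using step_sum assignment_sum_le[OF xa] by simp
qed

text \<open>The critical tie at \<open>w\<close> is kept, and the head moves down as a whole by one
  amount that is too small for it to be overtaken by other edges of the tie. So no edge enters the
  tail.\<close>

lemma step_tail_W:
  assumes w: "w \<in> Ws G" and e: "e \<in> tail G y w"
  shows "e \<in> tail G x w"
proof (cases "filled G x w")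
  case False
  then show ?thesis using tailI_unfilled[OF _ xa tail_inc[OF e]] w by simp
next
  case fl: True
  have v: "w \<in> Fs G \<union> Ws G" using w by simp
  \<comment> \<open>A raised edge is in the tail of \<open>x\<close> at \<open>w\<close> and a cut
    one in the critical tie; neither lies beyond it.\<close>
  have beyond: "y e' = 0" if e': "e' \<in> inc G w" "cri x w < rk w e'" for e'
  proof -
    have we: "snd e' = w" "fst e' \<in> Fs G" using inc_W[OF w] edge_vertices[OF inc_edge] e' by auto
    have x0: "x e' = 0" using zero_beyond[OF v xa fl] e' by simp
    have "e' \<notin> head G x w" using headD(3)[OF v xa] e'(2) by fastforce
    moreover have "e' \<notin> tail G x w"
      using tail_iff[OF v, of x e'] assignment_nonneg[OF xa] fl e'(2) by auto
    then have "e' \<notin> D G x (fst e')"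
      using D_props(3)[OF we(2)] we(1) by blast
    ultimately show ?thesis using x0 we by (simp add: y_def Delta_eq up_def down_def)
  qed
  have "sum y {e \<in> inc G w. rk w e \<le> cri x w} = sum y (inc G w)"
  proof (rule sum.mono_neutral_left, goal_cases)
    case 3
    show ?case using beyond by fastforce
  qed auto
  then have "quota G w \<le> sum y {e \<in> inc G w. rk w e \<le> cri x w}"
    using step_sum[OF v] fl by (simp add: filled_def)
  then have c: "cri y w = cri x w"
    using near_better_sum[OF sm _ v fl, of y] step_near assignment_nonneg[OF step_assignment]
    by (intro crit_index_eqI(2)[OF v]) auto
  have ei: "e \<in> inc G w" using e by (rule tail_inc)
  have fly: "filled G y w" using step_filled[OF v] fl by simp
  show ?thesis
  proof (rule ccontr)
    assume nt: "e \<notin> tail G x w"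
    have "e \<in> tail G y w \<longleftrightarrow> e \<in> inc G w \<and> (\<not> filled G y w \<or> rk w e < cri y w
    \<or> (rk w e = cri y w \<and> (\<exists>e'\<in>inc G w. rk w e' = cri y w \<and> y e < y e')))"
      using assignment_nonneg[OF step_assignment] by (intro tail_iff[OF v]) simp
    moreover have "\<not> rk w e < cri x w" using tailI_better[OF v xa ei] nt by blast
    ultimately obtain e' where e': "rk w e = cri x w" "e' \<in> inc G w" "rk w e' = cri x w" "y e < y e'"
      using e fly c by auto
    have h: "e \<in> head G x w" using headI[OF v xa ei nt] e' by simp
    have down: "y d = x d - (if w \<in> Wplus G x then \<psi> w else 0)" if d: "d \<in> head G x w" for d
    proof -
      have "snd d = w" using headD(2)[OF v xa d] inc_W[OF w] by simp
      then show ?thesis using up_zero_head[of d \<phi>] d by (simp add: y_def Delta_eq down_def)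
    qed
    show False
    proof (cases "e' \<in> head G x w")
      case True
      then show ?thesis
        using down[OF h] down[OF True] headD(4)[OF v xa h e'(2,3)] e'(4) by simp
    next
      case False
      then have "e' \<in> tail G x w" using headI[OF v xa e'(2)] e'(3) by auto
      moreover have "e' \<in> tail G x w \<longleftrightarrow> e' \<in> inc G w \<and> (\<not> filled G x w \<or> rk w e' < cri x w
        \<or> (rk w e' = cri x w \<and> (\<exists>e\<in>inc G w. rk w e = cri x w \<and> x e' < x e)))"
        using assignment_nonneg[OF xa] by (intro tail_iff[OF v]) simp
      ultimately obtain d where d: "d \<in> inc G w" "rk w d = cri x w" "x e' < x d"
        using fl e'(3) by auto
      then have "x e' < x e" using headD(4)[OF v xa h] by fastforce
      then have "y e' < y e"
        using near_order[OF sm _ inc_edge[OF e'(2)] inc_edge[OF ei], of y] step_near by simp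
      then show False using e'(4) by simp
    qed
  qed
qed

text \<open>Past the tie of \<open>D G x f\<close> both \<open>x\<close> and the step vanish, while
  \<open>e0\<close> itself becomes positive. So the quota is reached exactly there, even if this tie
  was beyond the critical one of \<open>x\<close>.\<close>

lemma step_crit_F:
  assumes f: "f \<in> Fs G" and e0: "e0 \<in> inc G f" "0 < Delta G x \<phi> \<psi> e0"
  shows "cri y f = rk f e0"
proof -
  have v: "f \<in> Fs G \<union> Ws G" using f by simp
  have e0D: "e0 \<in> D G x f" using Delta_pos[OF step_facts(2) e0(2)] inc_F[OF f e0(1)] by simp
  note fl = D_crit[OF f e0D]
  have beyond: "y e' = 0" if e': "e' \<in> inc G f" "rk f e0 < rk f e'" for e'
  proof -
    have fe: "fst e' = f" "snd e' \<in> Fs G \<union> Ws G" using inc_F[OF f] edge_vertices[OF inc_edge] e' by auto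
    have x0: "x e' = 0" using zero_beyond[OF v xa fl(1) e'(1)] fl(2) e'(2) by simp
    have "e' \<notin> D G x f" using D_props(4)[OF f e0D] e'(2) by fastforce
    moreover have "e' \<notin> head G x (snd e')" using headD(5)[OF fe(2) xa] x0 by fastforce
    ultimately show ?thesis using x0 fe by (simp add: y_def Delta_eq up_def down_def)
  qed
  have tot: "sum y {e \<in> inc G f. rk f e \<le> rk f e0} = sum y (inc G f)"
  proof (rule sum.mono_neutral_left, goal_cases)
    case 3
    show ?case using beyond by fastforce
  qed auto
  have q: "sum y (inc G f) = quota G f" using step_sum[OF v] fl by (simp add: filled_def)
  have "0 < y e0" using e0(2) assignment_nonneg[OF xa, of e0] by (simp add: y_def)
  then have "sum y {e \<in> inc G f. rk f e < rk f e0} < sum y {e \<in> inc G f. rk f e \<le> rk f e0}"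
    using e0(1) assignment_nonneg[OF step_assignment] by (intro sum_strict_mono2[of _ _ e0]) auto
  then show ?thesis
    using tot q assignment_nonneg[OF step_assignment] by (intro crit_index_eqI(2)[OF v]) auto
qed

text \<open>On \<open>D G x f\<close> the assignment \<open>x\<close> is constant and maximal in the
  tie; all of it rises equally and nothing else in the tie rises.\<close>

lemma step_head_F:
  assumes f: "f \<in> Fs G" and e0: "e0 \<in> inc G f" "0 < Delta G x \<phi> \<psi> e0" and e: "e \<in> D G x f"
  shows "e \<notin> tail G y f"
proof
  assume t: "e \<in> tail G y f"
  have v: "f \<in> Fs G \<union> Ws G" using f by simp
  have e0D: "e0 \<in> D G x f" and fp: "f \<in> Fplus G x"
    using Delta_pos[OF step_facts(2) e0(2)] inc_F[OF f e0(1)] by auto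
  have c: "cri y f = rk f e" using step_crit_F[OF f e0] D_props(4)[OF f e e0D] by simp
  have "filled G y f" using step_filled[OF v] D_crit(1)[OF f e] by simp
  then obtain e' where e': "e' \<in> inc G f" "rk f e' = rk f e" "y e < y e'"
    using t tail_iff[OF v, of y e] assignment_nonneg[OF step_assignment] c by auto
  have yD: "y d = x d + \<phi> f" if d: "d \<in> D G x f" for d
  proof -
    have "fst d = f" using D_props(1)[OF f d] inc_F[OF f] by simp
    then show ?thesis using D_disjoint_head[OF f d] d fp by (simp add: y_def Delta_eq up_def down_def)
  qed
  show False
  proof (cases "e' \<in> D G x f")
    case True
    then show ?thesis using yD[OF e] yD[OF True] D_const[OF f e True] e'(3) by simp
  next
    case False
    then have "\<not> 0 < Delta G x \<phi> \<psi> e'"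
      using Delta_pos(2)[OF step_facts(2), of \<phi> e'] inc_F[OF f e'(1)] by auto
    then have "y e' \<le> x e'" by (simp add: y_def)
    then show False
      using D_max[OF f e e'(1,2)] yD[OF e] step_facts(1) fp e'(3) by force
  qed
qed

text \<open>If \<open>f\<close> is untouched, this is stability of \<open>x\<close>. Otherwise an
  edge of rank up to the new critical tie belongs to \<open>D G x f\<close> by minimality, and
  \<open>D G x f\<close> is no longer beatable. Both the stability of the step and the comparison in
  (b) rest on this.\<close>

lemma step_tail_F:
  assumes f: "f \<in> Fs G" and ei: "e \<in> inc G f" and cap: "x e < cap G e"
    and tw: "e \<in> tail G x (snd e)"
  shows "e \<notin> tail G y f"
proof
  assume t: "e \<in> tail G y f"
  have v: "f \<in> Fs G \<union> Ws G" using f by simp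
  have nt: "e \<notin> tail G x f"
    using stable_not_tail[OF xs inc_edge[OF ei] cap] tw inc_F[OF f ei] by auto
  have "\<exists>e\<in>inc G f. Delta G x \<phi> \<psi> e \<noteq> 0"
  proof (rule ccontr)
    assume "\<not> (\<exists>e\<in>inc G f. Delta G x \<phi> \<psi> e \<noteq> 0)"
    then have "tail G x f = tail G y f"
      using assignment_nonneg[OF xa] by (intro tail_cong[OF v]) (auto simp: y_def)
    then show False using nt t by simp
  qed
  then obtain e1 where "e1 \<in> inc G f" "0 \<noteq> Delta G x \<phi> \<psi> e1" by auto
  \<comment> \<open>The step sums to zero at \<open>f\<close>, so a nonzero entry forces a positive
    one.\<close>
  then obtain e0 where e0: "e0 \<in> inc G f" "0 < Delta G x \<phi> \<psi> e0"
    by (rule sums_differ[OF finite_inc, of "\<lambda>_. 0" f "Delta G x \<phi> \<psi>", rotated])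
      (simp_all add: step_facts(4)[OF v])
  have e0D: "e0 \<in> D G x f" using Delta_pos[OF step_facts(2) e0(2)] inc_F[OF f e0(1)] by simp
  have "filled G y f" using step_filled[OF v] D_crit(1)[OF f e0D] by simp
  then have "rk f e \<le> rk f e0"
    using t tail_iff[OF v, of y e] assignment_nonneg[OF step_assignment] step_crit_F[OF f e0] by auto
  then have "e \<in> D G x f" using D_props(7)[OF f e0D ei _ cap tw] by simp
  then show False using step_head_F[OF f e0] t by simp
qed

text \<open>A blocking edge would be in the tail of \<open>x\<close> at \<open>w\<close>, hence not
  a cut edge, hence unsaturated already in \<open>x\<close>; \<open>step_tail_F\<close> excludes
  it.\<close>

lemma step_stable: "y \<in> stable_set G"
  unfolding stable_set_def mem_Collect_eq
proof (intro conjI allI notI)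
  show "assignment G y" by (rule step_assignment)
  fix e assume b: "blocking G y e"
  then have e: "e \<in> edges G" "y e < cap G e" "e \<in> tail G y (fst e)" "e \<in> tail G y (snd e)"
    by (auto simp: blocking_def)
  have f: "fst e \<in> Fs G" and w: "snd e \<in> Ws G" using edge_vertices[OF e(1)] by auto
  have tw: "e \<in> tail G x (snd e)" using step_tail_W[OF w e(4)] .
  then have "e \<notin> head G x (snd e)" using headD(6)[OF _ xa] w by blast
  then have "\<not> Delta G x \<phi> \<psi> e < 0" using Delta_neg(2)[OF step_facts(1)] by blast
  then have "x e < cap G e" using e(2) by (simp add: y_def)
  then show False using step_tail_F[OF f _ _ tw] edge_inc[OF e(1)] e(3) by simp
qed

lemma step_prefF: "prefF G x y"
  unfolding prefF_iff
proof (intro conjI ballI xs step_stable)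
  fix f assume f: "f \<in> Fs G"
  show "dom f x y"
    unfolding dom_def
  proof (intro ballI)
    fix e assume e: "e \<in> tail G x f"
    then have "fst e = f" using inc_F[OF f tail_inc] by simp
    then have "\<not> 0 < Delta G x \<phi> \<psi> e"
      using Delta_pos(2)[OF step_facts(2), of \<phi> e] D_not_tail[OF f, of e] e by auto
    then show "y e \<le> x e" by (simp add: y_def)
  qed
qed

lemma step_X_eps: "y \<in> X_eps G x \<epsilon>"
proof -
  have "\<epsilon> > 0" using sm by (simp add: small_def)
  then have "x \<noteq> y" using step_near by (auto simp: norm1_def)
  then show ?thesis
    using step_near step_stable step_prefF by (simp add: X_eps_def sprefF_def)
qed

end


subsection \<open>Active structure and worse stable assignments\<close>

context
  fixes y :: "'v evec"
  assumes p: "prefF G x y"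
begin

lemma ys: "y \<in> stable_set G"
  using p by (simp add: prefF_iff)

lemma ya: "assignment G y"
  using stable_assignment[OF ys] .

lemma p_dom: "f \<in> Fs G \<Longrightarrow> dom f x y"
  using p by (simp add: prefF_iff)

text \<open>The delicate point is that no tie up to that of \<open>e\<close> has an unsaturated edge
  \<open>e'\<close> to a deficit vertex. Such an \<open>e'\<close> would keep its value and, by
  stability of \<open>y\<close>, be a head edge of \<open>y\<close> in the tie of \<open>e\<close>;
  then \<open>x e < y e \<le> y e' = x e'\<close> puts \<open>e\<close> into the tail of
  \<open>x\<close> at \<open>f\<close>, where no increase is possible.\<close>

lemma increase_cand:
  assumes e: "e \<in> edges G" and gt: "x e < y e"
  shows "filled G x (fst e)" "filled G x (snd e)" "e \<in> tail G x (snd e)" "x e < cap G e"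
    "e \<notin> tail G x (fst e)" "rk (fst e) e \<in> cand_ties G x (fst e)"
proof -
  define f where "f = fst e"
  have f: "f \<in> Fs G" and w: "snd e \<in> Ws G" using edge_vertices[OF e] by (auto simp: f_def)
  then have v: "f \<in> Fs G \<union> Ws G" "snd e \<in> Fs G \<union> Ws G" by auto
  have ei: "e \<in> inc G f" "e \<in> inc G (snd e)" using edge_inc[OF e] by (auto simp: f_def)
  have flf: "filled G x f" using prefF_unfilled_eq[OF p v(1) _ ei(1)] gt by force
  show "filled G x (fst e)" using flf by (simp add: f_def)
  show flw: "filled G x (snd e)" using prefF_unfilled_eq[OF p v(2) _ ei(2)] gt by force
  show tw: "e \<in> tail G x (snd e)"
    using dom_not_tail_le[OF v(2) ya xa prefF_dom_W[OF p w] ei(2)] gt by force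
  show cap: "x e < cap G e" using gt assignment_le_cap[OF ya e] by simp
  show nt: "e \<notin> tail G x (fst e)" using p_dom[OF f] gt by (auto simp: dom_def f_def)
  have fly: "filled G y f" using prefF_filled[OF p v(1)] flf by simp
  have posy: "0 < y e" using gt assignment_nonneg[OF xa, of e] by simp
  show "rk (fst e) e \<in> cand_ties G x (fst e)"
    unfolding f_def[symmetric] cand_iff[OF f]
  proof (intro conjI bexI ballI impI notI)
    fix e' assume e': "e' \<in> inc G f" "rk f e' \<le> rk f e" "x e' < cap G e'" "deficit G x (snd e')"
    have ed: "e' \<in> edges G" using inc_edge[OF e'(1)] .
    have fe: "fst e' = f" using inc_F[OF f e'(1)] .
    have w': "snd e' \<in> Fs G \<union> Ws G" using edge_vertices[OF ed] by simp
    have nf: "\<not> filled G x (snd e')" using deficit_iff[OF xa w'] e'(4) by simp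
    have eq: "y e' = x e'"
      using prefF_unfilled_eq[OF p w' nf] edge_inc[OF ed] by simp
    have "e' \<in> tail G y (snd e')"
      using tailI_unfilled[OF w' ya] edge_inc[OF ed] nf prefF_filled[OF p w'] by simp
    then have nt': "e' \<notin> tail G y f"
      using stable_not_tail[OF ys ed] e'(3) eq fe by auto
    have "cri y f \<le> rk f e'" using not_tail_crit[OF v(1) ya e'(1) nt'] by simp
    moreover have le: "rk f e \<le> cri y f" using pos_le_crit[OF v(1) ya fly ei(1) posy] .
    ultimately have rk: "rk f e' = rk f e" "rk f e = cri y f" using e'(2) by auto
    have "e' \<in> head G y f" using headI[OF v(1) ya e'(1) nt'] rk by simp
    then have "y e \<le> y e'" using headD(4)[OF v(1) ya _ ei(1)] rk by simp
    then have lt: "x e < x e'" using eq gt by simp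
    have "0 < x e'" using lt assignment_nonneg[OF xa, of e] by simp
    then have "rk f e' \<le> cri x f" using pos_le_crit[OF v(1) xa flf e'(1)] by simp
    moreover have "cri x f \<le> rk f e" using not_tail_crit[OF v(1) xa ei(1)] nt by (simp add: f_def)
    ultimately have "e \<in> tail G x f" using tailI_crit[OF v(1) xa ei(1) _ e'(1) _ lt] rk by simp
    then show False using nt by (simp add: f_def)
  qed (use ei tw cap in auto)
qed

lemma moved_increases:
  assumes v: "v \<in> Fs G \<union> Ws G" and e: "e \<in> inc G v" "x e \<noteq> y e"
  obtains e' where "e' \<in> inc G v" "x e' < y e'"
  using sums_differ[OF finite_inc prefF_sum_eq[OF p v] e] by blast

lemma moved_decreases:
  assumes v: "v \<in> Fs G \<union> Ws G" and e: "e \<in> inc G v" "x e \<noteq> y e"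
  obtains e' where "e' \<in> inc G v" "y e' < x e'"
  using sums_differ[OF finite_inc prefF_sum_eq[OF p v, symmetric] e(1)] e(2) by metis

lemma moved_filled:
  assumes v: "v \<in> Fs G \<union> Ws G" and e: "e \<in> inc G v" "x e \<noteq> y e"
  shows "filled G x v" "filled G y v"
  using prefF_unfilled_eq[OF p v _ e(1)] e(2) prefF_filled[OF p v] by auto

text \<open>\<open>dom_head_less\<close> with \<open>x\<close> and \<open>y\<close> exchanged, since
  \<open>W\<close> prefers \<open>y\<close>; no closeness is involved.\<close>

lemma moved_head_W:
  assumes w: "w \<in> Ws G" and e: "e \<in> inc G w" "x e \<noteq> y e" and h: "h \<in> head G x w"
  shows "y h < x h"
proof -
  have v: "w \<in> Fs G \<union> Ws G" using w by simp
  obtain e' where e': "e' \<in> inc G w" "y e' < x e'" using moved_decreases[OF v e] .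
  show ?thesis
    using dom_head_less[OF v ya xa prefF_dom_W[OF p w] moved_filled(2,1)[OF v e] e' h] .
qed

text \<open>In the last item stability of \<open>y\<close> removes \<open>d\<close> from the tail at
  \<open>f\<close>. Its two premises hold when \<open>y\<close> is near \<open>x\<close>, and also
  when \<open>y\<close> agrees with \<open>x\<close> at \<open>snd d\<close>.\<close>

lemma moved_D_F:
  assumes f: "f \<in> Fs G" and e: "e \<in> inc G f" "x e \<noteq> y e"
  shows "D G x f \<noteq> {}"
    "d \<in> D G x f \<Longrightarrow> rk f d \<le> cri y f"
    "d \<in> D G x f \<Longrightarrow> y d < cap G d \<Longrightarrow> d \<in> tail G y (snd d) \<Longrightarrow> d \<in> head G y f \<and> rk f d = cri y f \<and> x d < y d"
proof -
  have v: "f \<in> Fs G \<union> Ws G" using f by simp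
  obtain e' where e': "e' \<in> inc G f" "x e' < y e'" using moved_increases[OF v e] .
  have fe: "fst e' = f" using inc_F[OF f e'(1)] .
  have cand: "rk f e' \<in> cand_ties G x f"
    using increase_cand(6)[OF inc_edge[OF e'(1)] e'(2)] fe by simp
  show "D G x f \<noteq> {}" using D_nonempty[OF f cand] .
  have fl: "filled G x f" "filled G y f" using moved_filled[OF v e] by auto
  have "0 < y e'" using e'(2) assignment_nonneg[OF xa, of e'] by simp
  then have le: "rk f e' \<le> cri y f" using pos_le_crit[OF v ya fl(2) e'(1)] by simp
  assume d: "d \<in> D G x f"
  show 1: "rk f d \<le> cri y f" using D_props(5)[OF f d cand] le by simp
  assume cap: "y d < cap G d" and t: "d \<in> tail G y (snd d)"
  have di: "d \<in> inc G f" "fst d = f" using D_props(1)[OF f d] inc_F[OF f] by auto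
  have nt: "d \<notin> tail G y f" using stable_not_tail[OF ys inc_edge[OF di(1)] cap] t di(2) by auto
  have h: "d \<in> head G y f" using headI[OF v ya di(1) nt 1] .
  moreover have "x d < y d" using dom_head_less[OF v xa ya p_dom[OF f] fl e' h] .
  ultimately show "d \<in> head G y f \<and> rk f d = cri y f \<and> x d < y d"
    using headD(3)[OF v ya h] by simp
qed

text \<open>If \<open>y\<close> agreed with \<open>x\<close> around \<open>snd d\<close>, then
  \<open>d\<close> would stay available there and would have to increase, which contradicts the
  agreement.\<close>

lemma moved_D_closed:
  assumes f: "f \<in> Fs G" and e: "e \<in> inc G f" "x e \<noteq> y e" and d: "d \<in> D G x f"
  shows "\<exists>e'\<in>inc G (snd d). x e' \<noteq> y e'"
proof (rule ccontr)
  assume "\<not> ?thesis"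
  then have eq: "\<forall>e'\<in>inc G (snd d). x e' = y e'" by blast
  have ed: "d \<in> edges G" using inc_edge[OF D_props(1)[OF f d]] .
  have w: "snd d \<in> Fs G \<union> Ws G" using edge_vertices[OF ed] by simp
  have "tail G x (snd d) = tail G y (snd d)"
    using assignment_nonneg[OF xa] by (intro tail_cong[OF w eq]) auto
  moreover have "x d = y d" using eq edge_inc[OF ed] by blast
  ultimately show False
    using moved_D_F(3)[OF f e d] D_props(2,3)[OF f d] by simp
qed

lemma moved_head_closed:
  assumes w: "w \<in> Ws G" and e: "e \<in> inc G w" "x e \<noteq> y e" and h: "h \<in> head G x w"
  shows "\<exists>e'\<in>inc G (fst h). x e' \<noteq> y e'"
proof -
  have "h \<in> edges G" using inc_edge[OF headD(2)[OF _ xa h]] w by simp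
  then show ?thesis
    using moved_head_W[OF assms] edge_inc by (intro bexI[of _ h]) auto
qed

text \<open>The vertices around which \<open>x\<close> and \<open>y\<close> agree satisfy every rule
  generating \<open>V0\<close>. So all movement is confined to \<open>Fplus\<close> and
  \<open>Wplus\<close>.\<close>

lemma V0_unmoved:
  assumes "v \<in> V0 G x"
  shows "\<forall>e\<in>inc G v. x e = y e"
  using assms
proof (induction rule: V0.induct)
  case (W_deficit w f)
  have w: "w \<in> Ws G" "w \<in> Fs G \<union> Ws G" using W_deficit by (auto simp: Weq_def)
  have ed: "(f, w) \<in> edges G" using inc_edge[OF headD(2)[OF w(2) xa W_deficit(2)]] .
  then have f: "f \<in> Fs G \<union> Ws G" using edge_vertices[OF ed] by simp
  then have "\<not> filled G x f" using deficit_iff[OF xa f] W_deficit(3) by simp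
  then have "x (f, w) = y (f, w)"
    using prefF_unfilled_eq[OF p f] edge_inc[OF ed] by simp
  then show ?case using moved_head_W[OF w(1) _ _ W_deficit(2)] by force
next
  case (F_empty f)
  then show ?case using moved_D_F(1)[of f] by (auto simp: Feq_def)
next
  case (F_step f w)
  then show ?case using moved_D_closed[of f _ "(f, w)"] by (fastforce simp: Feq_def)
next
  case (W_step w f)
  then show ?case using moved_head_closed[of w _ "(f, w)"] by (fastforce simp: Weq_def)
qed

lemma moved_F:
  "f \<in> Fs G \<Longrightarrow> e \<in> inc G f \<Longrightarrow> x e \<noteq> y e \<Longrightarrow> f \<in> Fplus G x"
  using V0_unmoved[of f] moved_filled(1)[of f e] by (auto simp: Fplus_def Feq_def)

lemma moved_W:
  "w \<in> Ws G \<Longrightarrow> e \<in> inc G w \<Longrightarrow> x e \<noteq> y e \<Longrightarrow> w \<in> Wplus G x"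
  using V0_unmoved[of w] moved_filled(1)[of w e] by (auto simp: Wplus_def Weq_def)


section \<open>Worse stable assignments close to x\<close>

lemma near_crit_W:
  assumes sm: "small x \<epsilon>" and near: "norm1 G (\<lambda>e. y e - x e) \<le> \<epsilon>"
    and w: "w \<in> Ws G" and fl: "filled G x w"
  shows "cri x w = cri y w"
proof -
  have v: "w \<in> Fs G \<union> Ws G" using w by simp
  have fl': "filled G y w" using prefF_filled[OF p v] fl by simp
  \<comment> \<open>Closeness prevents the critical tie from improving, and the preference of
    \<open>W\<close> for \<open>y\<close> prevents it from getting worse.\<close>
  show ?thesis
    using near_crit_le[OF sm near v fl fl' ya] dom_crit_le[OF v ya xa prefF_dom_W[OF p w] fl' fl]
    by simp
qed

context
  fixes \<epsilon> :: real
  assumes sm: "small x \<epsilon>" and near: "norm1 G (\<lambda>e. y e - x e) \<le> \<epsilon>"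
begin

lemma near_D:
  assumes f: "f \<in> Fs G" and e: "e \<in> inc G f" "x e \<noteq> y e" and d: "d \<in> D G x f"
  shows "d \<in> head G y f \<and> rk f d = cri y f \<and> x d < y d"
proof -
  have ed: "d \<in> edges G" using inc_edge[OF D_props(1)[OF f d]] .
  have w: "snd d \<in> Ws G" using edge_vertices[OF ed] by simp
  have fl: "filled G x (snd d)" using D_filled_W[OF f d] .
  have "d \<in> tail G y (snd d)"
    using near_tail[OF sm near _ xa ya fl near_crit_W[OF sm near w fl] D_props(3)[OF f d]] w by simp
  then show ?thesis
    using moved_D_F(3)[OF f e d] near_cap[OF sm near ed D_props(2)[OF f d]] by blast
qed

text \<open>By \<open>near_D\<close> the critical tie of \<open>y\<close> at \<open>f\<close> is
  that of \<open>D G x f\<close>, so a positive edge has no worse rank, and minimality puts it into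
  \<open>D\<close>.\<close>

lemma near_increase_D:
  assumes f: "f \<in> Fs G" and e: "e \<in> inc G f" "x e < y e"
  shows "e \<in> D G x f"
proof -
  have ne: "x e \<noteq> y e" using e by simp
  have v: "f \<in> Fs G \<union> Ws G" using f by simp
  obtain d where d: "d \<in> D G x f" using moved_D_F(1)[OF f e(1) ne] by blast
  have "0 < y e" using e(2) assignment_nonneg[OF xa, of e] by simp
  then have "rk f e \<le> rk f d"
    using pos_le_crit[OF v ya moved_filled(2)[OF v e(1) ne] e(1)] near_D[OF f e(1) ne d] by simp
  then show ?thesis
    using D_props(7)[OF f d e(1)] increase_cand(3,4)[OF inc_edge[OF e(1)] e(2)] by simp
qed

lemma near_D_ge:
  assumes f: "f \<in> Fs G" and d: "d \<in> D G x f"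
  shows "x d \<le> y d"
  using near_D[OF f D_props(1)[OF f d] _ d] by force

lemma near_D_const:
  assumes f: "f \<in> Fs G" and d: "d \<in> D G x f" and d': "d' \<in> D G x f"
  shows "y d - x d = y d' - x d'"
proof (cases "\<exists>e\<in>inc G f. x e \<noteq> y e")
  case True
  then obtain e where e: "e \<in> inc G f" "x e \<noteq> y e" by blast
  have v: "f \<in> Fs G \<union> Ws G" using f by simp
  have "d \<in> head G y f" "d' \<in> head G y f" using near_D[OF f e] d d' by auto
  then have "y d = y d'" using headD(2,3,4)[OF v ya] by (meson order_antisym)
  then show ?thesis using D_const[OF f d d'] by simp
next
  case False
  then show ?thesis using D_props(1)[OF f d] D_props(1)[OF f d'] by simp
qed

text \<open>\<open>W\<close> prefers \<open>y\<close>, so a decreased edge is outside the tail of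
  \<open>y\<close>, and by closeness outside that of \<open>x\<close>; being positive in
  \<open>x\<close>, it is not beyond the critical tie.\<close>

lemma near_decrease_head:
  assumes w: "w \<in> Ws G" and e: "e \<in> inc G w" "y e < x e"
  shows "e \<in> head G x w \<and> e \<in> head G y w"
proof -
  have v: "w \<in> Fs G \<union> Ws G" using w by simp
  have ne: "x e \<noteq> y e" using e by simp
  have fl: "filled G x w" using moved_filled(1)[OF v e(1) ne] .
  have c: "cri x w = cri y w" using near_crit_W[OF sm near w fl] .
  have nt: "e \<notin> tail G y w" using prefF_dom_W[OF p w] e(2) by (auto simp: dom_def)
  then have nt': "e \<notin> tail G x w" using near_tail[OF sm near v xa ya fl c] by blast
  have "0 < x e" using e(2) assignment_nonneg[OF ya, of e] by simp
  then have "rk w e \<le> cri x w" using pos_le_crit[OF v xa fl e(1)] by simp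
  then show ?thesis using headI[OF v xa e(1) nt'] headI[OF v ya e(1) nt] c by simp
qed

lemma near_head_const:
  assumes w: "w \<in> Ws G" and h: "h \<in> head G x w" and h': "h' \<in> head G x w"
  shows "y h - x h = y h' - x h'"
proof -
  have v: "w \<in> Fs G \<union> Ws G" using w by simp
  have xeq: "x h = x h'" using headD(2,3,4)[OF v xa] h h' by (meson order_antisym)
  show ?thesis
  proof (cases "\<exists>e\<in>inc G w. x e \<noteq> y e")
    case True
    then obtain e where e: "e \<in> inc G w" "x e \<noteq> y e" by blast
    have "h \<in> head G y w" "h' \<in> head G y w"
      using near_decrease_head[OF w] moved_head_W[OF w e] h h' headD(2)[OF v xa] by auto
    then have "y h = y h'" using headD(2,3,4)[OF v ya] by (meson order_antisym)
    then show ?thesis using xeq by simp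
  next
    case False
    then show ?thesis using headD(2)[OF v xa h] headD(2)[OF v xa h'] by simp
  qed
qed

lemma near_is_step:
  "\<exists>\<phi> \<psi>. (\<phi>, \<psi>) \<in> P_eps G x (norm1 G (\<lambda>e. y e - x e)) \<and> y = (\<lambda>e. x e + Delta G x \<phi> \<psi> e)"
proof -
  \<comment> \<open>The chosen edge is immaterial by \<open>near_D_const\<close>, and likewise for
    \<open>\<psi>\<close> by \<open>near_head_const\<close>. The zeros elsewhere are demanded by
    \<open>P_eps\<close>.\<close>
  define \<phi> where "\<phi> f = (if f \<in> Fplus G x then let d = SOME d. d \<in> D G x f in y d - x d else 0)" for f
  define \<psi> where "\<psi> w = (if w \<in> Wplus G x then let h = SOME h. h \<in> head G x w in x h - y h else 0)" for w
  have \<phi>: "\<phi> f = y d - x d" if "f \<in> Fplus G x" "d \<in> D G x f" for f d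
    using that near_D_const[OF FplusD(1)[OF that(1)] that(2) someI[of "\<lambda>d. d \<in> D G x f", OF that(2)]]
    by (simp add: \<phi>_def Let_def)
  have \<psi>: "\<psi> w = x h - y h" if "w \<in> Wplus G x" "h \<in> head G x w" for w h
    using that near_head_const[OF WplusD(1)[OF that(1)] that(2) someI[of "\<lambda>h. h \<in> head G x w", OF that(2)]]
    by (simp add: \<psi>_def Let_def)
  have head_le: "y h \<le> x h" if "w \<in> Ws G" "h \<in> head G x w" for w h
    using moved_head_W[OF that(1) _ _ that(2), of h] headD(2)[OF _ xa that(2)] that(1) by force
  have \<phi>0: "\<forall>f\<in>Fplus G x. 0 \<le> \<phi> f"
  proof
    fix f assume f: "f \<in> Fplus G x"
    then obtain d where "d \<in> D G x f" using FplusD(3) by blast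
    then show "0 \<le> \<phi> f" using \<phi>[OF f] near_D_ge[OF FplusD(1)[OF f]] by simp
  qed
  have \<psi>0: "\<forall>w\<in>Wplus G x. 0 \<le> \<psi> w"
  proof
    fix w assume w: "w \<in> Wplus G x"
    then obtain h where "h \<in> head G x w" using WplusD(3) by blast
    then show "0 \<le> \<psi> w" using \<psi>[OF w] head_le[OF WplusD(1)[OF w]] by simp
  qed
  have Delta: "Delta G x \<phi> \<psi> e = y e - x e" for e
  proof (cases "e \<in> edges G")
    case False
    then show ?thesis using Delta_outside assignment_zero[OF xa] assignment_zero[OF ya] by simp
  next
    case e: True
    have f: "fst e \<in> Fs G" and w: "snd e \<in> Ws G" using edge_vertices[OF e] by auto
    have ei: "e \<in> inc G (fst e)" "e \<in> inc G (snd e)" using edge_inc[OF e] by auto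
    \<comment> \<open>Raise and cut are the positive and negative parts of
      \<open>y - x\<close>.\<close>
    have "up \<phi> e = max 0 (y e - x e)"
    proof (cases "fst e \<in> Fplus G x \<and> e \<in> D G x (fst e)")
      case True
      then show ?thesis using \<phi>[of "fst e" e] near_D_ge[OF f, of e] by (simp add: up_def)
    next
      case False
      then have "\<not> x e < y e"
        using near_increase_D[OF f ei(1)] moved_F[OF f ei(1)] by force
      then show ?thesis using False by (auto simp: up_def)
    qed
    moreover have "down \<psi> e = max 0 (x e - y e)"
    proof (cases "snd e \<in> Wplus G x \<and> e \<in> head G x (snd e)")
      case True
      then show ?thesis using \<psi>[of "snd e" e] head_le[OF w, of e] by (simp add: down_def)
    next
      case False
      then have "\<not> y e < x e"
        using near_decrease_head[OF w ei(2)] moved_W[OF w ei(2)] by force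
      then show ?thesis using False by (auto simp: down_def)
    qed
    ultimately show ?thesis by (simp add: Delta_eq)
  qed
  then have D: "Delta G x \<phi> \<psi> = (\<lambda>e. y e - x e)" by auto
  have "sum (Delta G x \<phi> \<psi>) (inc G v) = 0" if "v \<in> Fs G \<union> Ws G" for v
    using prefF_sum_eq[OF p that] by (simp add: D sum_subtractf)
  then have "(\<phi>, \<psi>) \<in> P_eps G x (norm1 G (\<lambda>e. y e - x e))"
    unfolding P_eps_iff using \<phi>0 \<psi>0 FplusD(1) WplusD(1) by (auto simp: D \<phi>_def \<psi>_def)
  then show ?thesis using D by (intro exI[of _ \<phi>] exI[of _ \<psi>]) auto
qed

end

section \<open>A balanced step towards an arbitrary worse stable assignment\<close>

definition moved :: "'v \<Rightarrow> bool" where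
  "moved v \<longleftrightarrow> (\<exists>e\<in>inc G v. x e \<noteq> y e)"

text \<open>The random walk that leaves a moved vertex \<open>f\<close> of the first class along a uniformly chosen edge
  of \<open>D G x f\<close>, and a moved vertex \<open>w\<close> of the second class along a uniformly chosen edge of
  \<open>head G x w\<close>, never leaves the moved vertices. Its stationary measures are the solutions of the
  balance equations.\<close>

lemma supported_P_eps_exists:
  assumes ne: "x \<noteq> y" and \<epsilon>: "0 \<le> \<epsilon>"
  shows "\<exists>\<phi> \<psi>. (\<phi>, \<psi>) \<in> P_eps G x \<epsilon> \<and> (\<forall>w. \<psi> w \<noteq> 0 \<longrightarrow> w \<in> Ws G \<and> moved w)"
proof -
  define A where "A = {f \<in> Fs G. moved f}"
  define B where "B = {w \<in> Ws G. moved w}"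
  define c where "c v = real (if v \<in> Fs G then card (D G x v) else card (head G x v))" for v
  define p' where "p' u v = (if u \<in> Fs G then if (u, v) \<in> D G x u then 1 / c u else 0
    else if (v, u) \<in> head G x u then 1 / c u else 0)" for u v
  have fin: "finite A" "finite B" using finite_Fs finite_Ws by (auto simp: A_def B_def)
  have disj: "A \<inter> B = {}" using disjoint_classes by (auto simp: A_def B_def)
  have AF: "A \<subseteq> Fplus G x" using moved_F by (auto simp: A_def moved_def)
  have BW: "B \<subseteq> Wplus G x" using moved_W by (auto simp: B_def moved_def)
  have BnF: "w \<notin> Fs G" if "w \<in> Ws G" for w using that disjoint_classes by blast
  have DB: "w \<in> B" if "f \<in> A" "(f, w) \<in> D G x f" for f w
  proof -
    have f: "f \<in> Fs G" using that by (simp add: A_def)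
    have "(f, w) \<in> edges G" using inc_edge[OF D_props(1)[OF f that(2)]] .
    then show ?thesis
      using that(1) moved_D_closed[OF f _ _ that(2)] edge_vertices by (fastforce simp: A_def B_def moved_def)
  qed
  have HA: "f \<in> A" if "w \<in> B" "(f, w) \<in> head G x w" for f w
  proof -
    have w: "w \<in> Ws G" "w \<in> Fs G \<union> Ws G" using that by (auto simp: B_def)
    have "(f, w) \<in> edges G" using inc_edge[OF headD(2)[OF w(2) xa that(2)]] .
    then show ?thesis
      using that(1) moved_head_closed[OF w(1) _ _ that(2)] edge_vertices by (fastforce simp: A_def B_def moved_def)
  qed
  have cpos: "0 < c v" if "v \<in> A \<union> B" for v
    using that
  proof
    assume v: "v \<in> A"
    then have "finite (D G x v)" using D_edges[of v] AF finite_subset[OF _ finite_inc] by blast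
    then show ?thesis using v AF FplusD(3)[of v] FplusD(1)[of v] by (auto simp: c_def card_gt_0_iff)
  next
    assume v: "v \<in> B"
    then have "finite (head G x v)" using head_edges[of v] BW finite_subset[OF _ finite_inc] by blast
    then show ?thesis using v BW WplusD(3)[of v] WplusD(1)[of v] BnF[of v] by (auto simp: c_def card_gt_0_iff)
  qed
  have row: "(\<Sum>v\<in>A \<union> B. p' u v) = 1" if u: "u \<in> A \<union> B" for u
  proof -
    \<comment> \<open>The successors of \<open>u\<close>. By \<open>DB\<close> and \<open>HA\<close>
      all of \<open>D G x u\<close>, or of the head, leads into \<open>A \<union> B\<close>, so
      their number is \<open>c u\<close>.\<close>
    define N where "N = {v \<in> A \<union> B. if u \<in> Fs G then (u, v) \<in> D G x u else (v, u) \<in> head G x u}"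
    have "(\<Sum>v\<in>A \<union> B. p' u v) = (\<Sum>v\<in>N. 1 / c u)"
      unfolding N_def p'_def using fin by (subst sum.inter_filter) (auto intro!: sum.cong)
    moreover have "real (card N) = c u"
      using u
    proof
      assume uA: "u \<in> A"
      then have F: "u \<in> Fs G" by (simp add: A_def)
      have "D G x u = Pair u ` N"
      proof (intro equalityI subsetI)
        fix e assume e: "e \<in> D G x u"
        then have "fst e = u" using inc_F[OF F D_props(1)[OF F]] by simp
        then have "e = (u, snd e)" by (simp add: prod_eq_iff)
        then show "e \<in> Pair u ` N" using DB[OF uA] e F unfolding N_def by (intro image_eqI[of _ _ "snd e"]) auto
      qed (auto simp: N_def F)
      then show ?thesis using F by (simp add: c_def card_image inj_on_def)
    next
      assume uB: "u \<in> B"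
      then have W: "u \<in> Ws G" "u \<notin> Fs G" using BnF by (auto simp: B_def)
      have "head G x u = (\<lambda>v. (v, u)) ` N"
      proof (intro equalityI subsetI)
        fix e assume e: "e \<in> head G x u"
        then have "snd e = u" using inc_W[OF W(1) headD(2)[OF _ xa]] W by simp
        then have "e = (fst e, u)" by (simp add: prod_eq_iff)
        then show "e \<in> (\<lambda>v. (v, u)) ` N" using HA[OF uB] e W unfolding N_def by (intro image_eqI[of _ _ "fst e"]) auto
      qed (auto simp: N_def W)
      then show ?thesis using W by (simp add: c_def card_image inj_on_def)
    qed
    ultimately show ?thesis using cpos[OF u] by simp
  qed
  obtain e where e: "x e \<noteq> y e" using ne by blast
  then have "e \<in> edges G" using assignment_zero[OF xa] assignment_zero[OF ya] by metis
  then have "fst e \<in> A"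
    using e edge_vertices[of e] edge_inc[of e] unfolding A_def moved_def by blast
  then have "\<exists>\<pi>. (\<forall>i\<in>A \<union> B. 0 \<le> \<pi> i) \<and> 0 < sum \<pi> (A \<union> B)
    \<and> (\<forall>j\<in>A \<union> B. (\<Sum>i\<in>A \<union> B. \<pi> i * p' i j) = \<pi> j)"
    using fin row cpos by (intro stationary_measure_exists) (auto simp: p'_def less_imp_le)
  then obtain \<pi> where \<pi>: "\<forall>i\<in>A \<union> B. 0 \<le> \<pi> i" "0 < sum \<pi> (A \<union> B)"
    "\<forall>j\<in>A \<union> B. (\<Sum>i\<in>A \<union> B. \<pi> i * p' i j) = \<pi> j" by blast
  \<comment> \<open>Scales the total mass to \<open>\<epsilon>\<close>, as the normalisation in
    \<open>P_eps\<close> requires.\<close>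
  define k where "k = \<epsilon> / sum \<pi> (A \<union> B)"
  have k: "0 \<le> k" using \<epsilon> \<pi>(2) by (simp add: k_def)
  \<comment> \<open>The share of the mass at \<open>f\<close> sent along each single edge of
    \<open>D G x f\<close>.\<close>
  define \<phi> where "\<phi> f = (if f \<in> A then k * \<pi> f / c f else 0)" for f
  define \<psi> where "\<psi> w = (if w \<in> B then k * \<pi> w / c w else 0)" for w
  have c\<phi>: "real (card (D G x f)) * \<phi> f = (if f \<in> A then k * \<pi> f else 0)" if "f \<in> Fplus G x" for f
    using cpos[of f] FplusD(1)[OF that] by (auto simp: \<phi>_def c_def)
  have c\<psi>: "real (card (head G x w)) * \<psi> w = (if w \<in> B then k * \<pi> w else 0)" if "w \<in> Wplus G x" for w
    using cpos[of w] BnF[OF WplusD(1)[OF that]] by (auto simp: \<psi>_def c_def)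
  have fin_plus: "finite (Fplus G x)" "finite (Wplus G x)"
    using finite_subset[OF _ finite_Fs] finite_subset[OF _ finite_Ws] FplusD(1) WplusD(1) by blast+
  have balF: "(\<Sum>w | w \<in> Wplus G x \<and> (f, w) \<in> head G x w. \<psi> w) = (if f \<in> A then k * \<pi> f else 0)"
    if f: "f \<in> Fplus G x" for f
  proof -
    have "(\<Sum>w | w \<in> Wplus G x \<and> (f, w) \<in> head G x w. \<psi> w) = (\<Sum>w\<in>{w \<in> B. (f, w) \<in> head G x w}. \<psi> w)"
      using BW fin_plus by (intro sum.mono_neutral_right) (auto simp: \<psi>_def)
    also have "\<dots> = (\<Sum>w\<in>B. k * (\<pi> w * p' w f))"
      using fin BnF by (subst sum.inter_filter) (auto simp: \<psi>_def p'_def B_def intro!: sum.cong)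
    also have "\<dots> = (if f \<in> A then k * \<pi> f else 0)"
    proof (cases "f \<in> A")
      case True
      \<comment> \<open>The walk alternates between the classes, so stationarity at \<open>f\<close>
        involves only inflow from \<open>B\<close>.\<close>
      have "\<pi> u * p' u f = 0" if "u \<in> A" for u
        using DB[OF that, of f] True disj that by (auto simp: p'_def A_def)
      then have "\<pi> f = (\<Sum>w\<in>B. \<pi> w * p' w f)"
        using \<pi>(3) True fin disj by (metis (no_types, lifting) UnI1 add_0 sum.neutral sum.union_disjoint)
      then show ?thesis using True by (simp add: sum_distrib_left)
    next
      \<comment> \<open>By \<open>HA\<close>, heads at moved vertices lead only to moved vertices,
        so an unmoved \<open>f\<close> receives nothing, in accordance with
        \<open>\<phi> f = 0\<close>.\<close>
      case False
      then have "p' w f = 0" if "w \<in> B" for w using HA[OF that, of f] that BnF by (auto simp: p'_def B_def)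
      then show ?thesis using False by simp
    qed
    finally show ?thesis .
  qed
  have balW: "(\<Sum>f | f \<in> Fplus G x \<and> (f, w) \<in> D G x f. \<phi> f) = (if w \<in> B then k * \<pi> w else 0)"
    if w: "w \<in> Wplus G x" for w
  proof -
    have "(\<Sum>f | f \<in> Fplus G x \<and> (f, w) \<in> D G x f. \<phi> f) = (\<Sum>f\<in>{f \<in> A. (f, w) \<in> D G x f}. \<phi> f)"
      using AF fin_plus by (intro sum.mono_neutral_right) (auto simp: \<phi>_def)
    also have "\<dots> = (\<Sum>f\<in>A. k * (\<pi> f * p' f w))"
      using fin by (subst sum.inter_filter) (auto simp: \<phi>_def p'_def A_def intro!: sum.cong)
    also have "\<dots> = (if w \<in> B then k * \<pi> w else 0)"
    proof (cases "w \<in> B")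
      case True
      have "\<pi> u * p' u w = 0" if "u \<in> B" for u
        using HA[OF that, of w] True disj that BnF by (auto simp: p'_def B_def)
      then have "\<pi> w = (\<Sum>f\<in>A. \<pi> f * p' f w)"
        using \<pi>(3) True fin disj by (metis (no_types, lifting) UnI2 add.right_neutral sum.neutral sum.union_disjoint)
      then show ?thesis using True by (simp add: sum_distrib_left)
    next
      case False
      then have "p' f w = 0" if "f \<in> A" for f using DB[OF that, of w] that by (auto simp: p'_def A_def)
      then show ?thesis using False by simp
    qed
    finally show ?thesis .
  qed
  have "(\<Sum>f\<in>Fplus G x. real (card (D G x f)) * \<phi> f) = (\<Sum>f\<in>A. k * \<pi> f)"
    using c\<phi> AF fin_plus by (simp add: sum.inter_restrict[symmetric] Int_absorb1)
  moreover have "(\<Sum>w\<in>Wplus G x. real (card (head G x w)) * \<psi> w) = (\<Sum>w\<in>B. k * \<pi> w)"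
    using c\<psi> BW fin_plus by (simp add: sum.inter_restrict[symmetric] Int_absorb1)
  ultimately have "(\<Sum>f\<in>Fplus G x. real (card (D G x f)) * \<phi> f)
    + (\<Sum>w\<in>Wplus G x. real (card (head G x w)) * \<psi> w) = (\<Sum>v\<in>A \<union> B. k * \<pi> v)"
    using fin disj by (simp add: sum.union_disjoint)
  also have "\<dots> = \<epsilon>" using \<pi>(2) unfolding sum_distrib_left[symmetric] by (simp add: k_def)
  finally have tot: "(\<Sum>f\<in>Fplus G x. real (card (D G x f)) * \<phi> f)
    + (\<Sum>w\<in>Wplus G x. real (card (head G x w)) * \<psi> w) = \<epsilon>" .
  have "0 \<le> \<phi> v" "0 \<le> \<psi> v" for v
    using k \<pi>(1) cpos[of v] by (auto simp: \<phi>_def \<psi>_def)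
  then have "(\<phi>, \<psi>) \<in> P_eps G x \<epsilon>"
    unfolding P_eps_def using c\<phi> c\<psi> balF balW tot AF BW by (auto simp: \<phi>_def \<psi>_def)
  then show ?thesis by (intro exI[of _ \<phi>] exI[of _ \<psi>]) (auto simp: \<psi>_def B_def)
qed

text \<open>The step must not overshoot \<open>y\<close>. A cut edge belongs to the head at a moved
  \<open>w\<close>, so by \<open>moved_head_W\<close> it also decreases towards \<open>y\<close>, by
  more than the step takes. For an edge that is not cut, exceeding the new value in \<open>y\<close>
  means exceeding \<open>x\<close>, and \<open>step_tail_F\<close> puts it outside the tail in
  question.\<close>

lemma intermediate_step:
  assumes ne: "x \<noteq> y" and sm: "small x \<epsilon>" and gap: "\<forall>e\<in>edges G. y e < x e \<longrightarrow> \<epsilon> < x e - y e"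
  shows "\<exists>x'\<in>X_eps G x \<epsilon>. prefF G x' y \<and> sprefF G x x'"
proof -
  have "0 \<le> \<epsilon>" using sm by (simp add: small_def)
  then obtain \<phi> \<psi> where P: "(\<phi>, \<psi>) \<in> P_eps G x \<epsilon>"
    and supp: "\<forall>w. \<psi> w \<noteq> 0 \<longrightarrow> w \<in> Ws G \<and> moved w"
    using supported_P_eps_exists[OF ne] by blast
  define x' where "x' = (\<lambda>e. x e + Delta G x \<phi> \<psi> e)"
  have X: "x' \<in> X_eps G x \<epsilon>" using step_X_eps[OF P sm] by (simp add: x'_def)
  have "dom f x' y" if f: "f \<in> Fs G" for f
    unfolding dom_def
  proof (intro ballI, rule ccontr)
    fix e assume t: "e \<in> tail G x' f" and "\<not> y e \<le> x' e"
    then have gt: "x' e < y e" by simp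
    have ei: "e \<in> inc G f" using tail_inc[OF t] .
    then have ed: "e \<in> edges G" using inc_edge by blast
    show False
    proof (cases "Delta G x \<phi> \<psi> e < 0")
      case True
      note h = Delta_neg[OF step_facts(1)[OF P sm] True]
      have "\<psi> (snd e) \<noteq> 0" using True step_facts(1)[OF P sm]
        by (auto simp: Delta_eq up_def down_def split: if_splits)
      then obtain e1 where "snd e \<in> Ws G" "e1 \<in> inc G (snd e)" "x e1 \<noteq> y e1"
        using supp by (auto simp: moved_def)
      then have "y e < x e" using moved_head_W[OF _ _ _ h(2)] by blast
      then have "\<epsilon> < x e - y e" using gap ed by blast
      moreover have "\<bar>Delta G x \<phi> \<psi> e\<bar> \<le> \<epsilon>"
        using norm1_bound[OF ed, of "Delta G x \<phi> \<psi>"] step_facts(3)[OF P sm] by simp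
      ultimately show False using gt by (simp add: x'_def)
    next
      case False
      then have "x e < y e" using gt by (simp add: x'_def)
      note inc = increase_cand[OF ed this]
      show False using step_tail_F[OF P sm f ei inc(4,3)] t by (simp add: x'_def)
    qed
  qed
  then have "prefF G x' y"
    using X ys by (simp add: prefF_iff X_eps_def)
  then show ?thesis using X by (auto simp: X_eps_def)
qed

end

end

end

theorem theorem1:
  fixes G :: "'v market" and x :: "'v evec"
  assumes "bipartite_market G"
    and "x \<in> stable_set G"
    and "x \<noteq> x_max G"
  shows "(\<forall>\<^sub>F \<epsilon> in at_right (0::real).
            X_eps G x \<epsilon> = {(\<lambda>e. x e + Delta G x \<phi> \<psi> e) | \<phi> \<psi>. (\<phi>, \<psi>) \<in> P_eps G x \<epsilon>})
       \<and> (\<forall>y\<in>stable_set G. sprefF G x y \<longrightarrow>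
            (\<forall>\<^sub>F \<epsilon> in at_right (0::real). \<exists>x'\<in>X_eps G x \<epsilon>. prefF G x' y \<and> sprefF G x x'))"
proof (intro conjI ballI impI)
  interpret bipartite_market G by (rule assms(1))
  note ev = eventually_small[OF stable_assignment[OF assms(2)]]
  show "\<forall>\<^sub>F \<epsilon> in at_right (0::real).
    X_eps G x \<epsilon> = {(\<lambda>e. x e + Delta G x \<phi> \<psi> e) | \<phi> \<psi>. (\<phi>, \<psi>) \<in> P_eps G x \<epsilon>}"
    using ev
  proof (rule eventually_mono)
    fix \<epsilon> :: real assume sm: "small x \<epsilon>"
    show "X_eps G x \<epsilon> = {(\<lambda>e. x e + Delta G x \<phi> \<psi> e) | \<phi> \<psi>. (\<phi>, \<psi>) \<in> P_eps G x \<epsilon>}"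
    proof (intro equalityI subsetI)
      fix y assume "y \<in> X_eps G x \<epsilon>"
      then have "prefF G x y" "norm1 G (\<lambda>e. y e - x e) = \<epsilon>"
        by (auto simp: X_eps_def sprefF_def)
      then show "y \<in> {(\<lambda>e. x e + Delta G x \<phi> \<psi> e) | \<phi> \<psi>. (\<phi>, \<psi>) \<in> P_eps G x \<epsilon>}"
        using near_is_step[OF assms(2) _ sm] by fastforce
    next
      fix y assume "y \<in> {(\<lambda>e. x e + Delta G x \<phi> \<psi> e) | \<phi> \<psi>. (\<phi>, \<psi>) \<in> P_eps G x \<epsilon>}"
      then show "y \<in> X_eps G x \<epsilon>" using step_X_eps[OF assms(2) _ sm] by blast
    qed
  qed
next
  interpret bipartite_market G by (rule assms(1))
  fix y assume "sprefF G x y"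
  then have y: "prefF G x y" "x \<noteq> y" by (auto simp: sprefF_def)
  \<comment> \<open>The threshold for \<open>\<epsilon>\<close> in (b) depends on \<open>y\<close>
    through these finitely many gaps.\<close>
  have "\<forall>\<^sub>F \<epsilon> in at_right (0::real). y e < x e \<longrightarrow> \<epsilon> < x e - y e" for e
    using eventually_at_right_real[of 0 "x e - y e"]
    by (cases "y e < x e") (auto elim: eventually_mono)
  then have "\<forall>\<^sub>F \<epsilon> in at_right (0::real). \<forall>e\<in>edges G. y e < x e \<longrightarrow> \<epsilon> < x e - y e"
    using finite_edges by (intro eventually_ball_finite) auto
  with eventually_small[OF stable_assignment[OF assms(2)]]
  show "\<forall>\<^sub>F \<epsilon> in at_right (0::real). \<exists>x'\<in>X_eps G x \<epsilon>. prefF G x' y \<and> sprefF G x x'"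
    by eventually_elim (rule intermediate_step[OF assms(2) y])
qed

end
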